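(* For every $k \geq 2$ and $\ell\ge 2$ we have $$\mathrm{ex}(n,P_k,C_{2\ell}) = \begin{cases} \Theta_k\big(n^{k/2 + 1}\big) & \text{if } \ell = 2, \\ \Theta_k\big( \ell^{\lfloor (k+1)/2 \rfloor} n^{\lceil (k+1)/2 \rceil}\big) & \text{if } \ell \geq 3. \end{cases}$$ Here the constants implicit in $\Theta_k$ depend only on $k$ (not on $\ell$ or $n$).
   Context: Graphs are finite and simple. $C_{2\ell}$ is the cycle of length $2\ell$, and $P_k$ is the path with $k$ edges. $\mathrm{ex}(n,T,H)$ is the maximum number of (unlabeled) copies of $T$ in an $n$-vertex graph that contains no copy of $H$ as a (not necessarily induced) subgraph. The notation $g(n,\ell)=\Theta_k(h(n,\ell))$ means: there are constants $0<a_k\le A_k$ depending only on $k$ such that $g(n,\ell)\le A_k h(n,\ell)$ for all $n\ge1$, and $g(n,\ell)\ge a_k h(n,\ell)$ for all $n\ge n_0(k,\ell)$. *)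

theory Defs
  imports Complex_Main "HOL-Library.Ramsey"
begin

type_synonym 'a sgraph = "'a set \<times> 'a set set"

abbreviation verts :: "'a sgraph \<Rightarrow> 'a set" where "verts G \<equiv> fst G"

abbreviation edges :: "'a sgraph \<Rightarrow> 'a set set" where "edges G \<equiv> snd G"

definition simple_graph :: "'a sgraph \<Rightarrow> bool" where
  "simple_graph G \<longleftrightarrow> finite (verts G) \<and> edges G \<subseteq> [verts G]\<^bsup>2\<^esup>"

definition subgraph :: "'a sgraph \<Rightarrow> 'a sgraph \<Rightarrow> bool" where
  "subgraph S G \<longleftrightarrow> simple_graph S \<and> verts S \<subseteq> verts G \<and> edges S \<subseteq> edges G"

definition graph_iso :: "'a sgraph \<Rightarrow> 'b sgraph \<Rightarrow> bool" where
  "graph_iso T S \<longleftrightarrow>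
    (\<exists>f. bij_betw f (verts T) (verts S) \<and> edges S = (\<lambda>e. f ` e) ` edges T)"

text \<open>Unlabeled copies are subgraphs, not embeddings: embeddings of \<open>T\<close> with the same image
  (differing by an automorphism of \<open>T\<close>) give a single copy.\<close>

definition copies :: "'a sgraph \<Rightarrow> 'b sgraph \<Rightarrow> 'b sgraph set" where
  "copies T G = {S. subgraph S G \<and> graph_iso T S}"

definition path_graph :: "nat \<Rightarrow> nat sgraph" where
  "path_graph k = ({0..k}, {{i, Suc i} | i. i < k})"

text \<open>This is the cycle of length \<open>m\<close> only for \<open>m \<ge> 3\<close>.\<close>

definition cycle_graph :: "nat \<Rightarrow> nat sgraph" where
  "cycle_graph m = ({0..<m}, {{i, Suc i mod m} | i. i < m})"

text \<open>The number \<open>ex(n,T,H)\<close>. Taking the vertices of the host graphs from the natural numbers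
  is no restriction, since every finite graph is isomorphic to such a graph. The maximum is over a
  finite set, which is nonempty as soon as \<open>H\<close> has an edge (shown below).\<close>

definition turan_counts :: "nat \<Rightarrow> 'a sgraph \<Rightarrow> 'b sgraph \<Rightarrow> nat set" where
  "turan_counts n T H =
    {card (copies T G) | G :: nat sgraph.
      simple_graph G \<and> card (verts G) = n \<and> copies H G = {}}"

definition gen_turan :: "nat \<Rightarrow> 'a sgraph \<Rightarrow> 'b sgraph \<Rightarrow> nat" where
  "gen_turan n T H = Max (turan_counts n T H)"

text \<open>Two-sided bound for functions of \<open>n\<close> and \<open>l\<close>, where \<open>l\<close> ranges over \<open>L\<close>. The constants
  \<open>a\<close> and \<open>A\<close> are uniform in \<open>l\<close> and \<open>n\<close>; only the threshold \<open>n0\<close> of the lower bound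
  may depend on \<open>l\<close>.\<close>

definition uniform_theta ::
    "nat set \<Rightarrow> (nat \<Rightarrow> nat \<Rightarrow> real) \<Rightarrow> (nat \<Rightarrow> nat \<Rightarrow> real) \<Rightarrow> bool" where
  "uniform_theta L g h \<longleftrightarrow>
    (\<exists>a A. 0 < a \<and> a \<le> A \<and>
      (\<forall>l\<in>L. (\<forall>n\<ge>1. g n l \<le> A * h n l) \<and>
              (\<exists>n0. \<forall>n\<ge>n0. a * h n l \<le> g n l)))"

lemma simple_graph_path_graph: "simple_graph (path_graph k)"
  by (auto simp: simple_graph_def path_graph_def)

lemma simple_graph_cycle_graph:
  assumes "m \<ge> 2"
  shows "simple_graph (cycle_graph m)"
proof -
  have "i \<noteq> Suc i mod m" if "i < m" for i
    using that assms by (cases "Suc i = m") auto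
  then show ?thesis
    using assms by (auto simp: simple_graph_def cycle_graph_def)
qed

lemma finite_turan_counts: "finite (turan_counts n T H)"
proof -
  have "card (copies T G) \<le> 2 ^ n * 2 ^ (n choose 2)"
    if G: "simple_graph G" "card (verts G) = n" for G :: "nat sgraph"
  proof -
    let ?U = "Pow (verts G) \<times> Pow ([verts G]\<^bsup>2\<^esup>)"
    have fin: "finite (verts G)" using G by (simp add: simple_graph_def)
    have "copies T G \<subseteq> ?U"
      using G by (fastforce simp: copies_def subgraph_def simple_graph_def)
    moreover have "finite ?U"
      using fin by (simp add: finite_imp_finite_nsets)
    ultimately have "card (copies T G) \<le> card ?U"
      by (rule card_mono[rotated])
    also have "card ?U = 2 ^ n * 2 ^ (n choose 2)"
      using fin G by (simp add: card_cartesian_product card_Pow card_nsets finite_imp_finite_nsets)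
    finally show ?thesis .
  qed
  then have "turan_counts n T H \<subseteq> {..2 ^ n * 2 ^ (n choose 2)}"
    by (auto simp: turan_counts_def)
  then show ?thesis by (rule finite_subset) simp
qed

lemma turan_counts_nonempty:
  assumes "edges H \<noteq> {}"
  shows "turan_counts n T H \<noteq> {}"
proof -
  have "copies H ({0..<n}, {}) = {}"
    using assms by (auto simp: copies_def subgraph_def graph_iso_def)
  moreover have "simple_graph ({0..<n}, {})" "card (verts ({0..<n}, {})) = n"
    by (simp_all add: simple_graph_def)
  ultimately show ?thesis
    unfolding turan_counts_def by blast
qed

end

theory Submission
  imports Defs "HOL-Algebra.Algebraic_Closure_Type"
begin

text \<open>
  Upper bounds. If the edges between a neighbourhood \<open>N(a)\<close> and any vertex set have average
  degree above \<open>4l\<close>, then a part of them has minimum degree above \<open>2l\<close> and contains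
  a greedy path with \<open>2l - 1\<close> vertices and both ends in \<open>N(a)\<close>, which
  \<open>a\<close> closes to a cycle of length \<open>2l\<close>. Hence \<open>O(l n)\<close> walks of length
  two start at each vertex, and each two further edges of a path cost a factor \<open>O(l n)\<close>. This
  leaves paths with two edges, which are clear, and paths \<open>a b c d\<close> with three edges. For pairs
  \<open>(a, c)\<close> of codegree at most \<open>4l\<close> it suffices that the degrees of the vertices
  \<open>c\<close> at distance two from \<open>a\<close> sum to \<open>O(l n)\<close>, where \<open>l \<ge>
  3\<close> is needed. The pairs of larger codegree span \<open>O(l d(c))\<close> paths \<open>a b c\<close>
  for each \<open>c\<close> of degree \<open>d(c)\<close>, and the squared degrees sum to \<open>O(l
  n\<^sup>2)\<close>. For \<open>l = 2\<close> at most \<open>n\<close> paths of length two start at each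
  vertex, and there are \<open>O(n\<^bsup>3/2\<^esup>)\<close> edges.

  Lower bounds. For \<open>l = 2\<close> take the incidence graph of points and lines over a field with
  \<open>2\<^bsup>r\<^esup>\<close> elements. For \<open>l \<ge> 3\<close> blow up the path: every other
  vertex (a hub) becomes \<open>t\<close> vertices, and the remaining ones become linearly many. If there are
  fewer than \<open>l\<close> hubs altogether, then a cycle of length \<open>2l\<close> does not fit; if
  \<open>l\<close> is too small for this, then \<open>t = 1\<close> and the only cycles have length four.
\<close>

section \<open>Path counts in graphs without a cycle of length \<open>2l\<close>\<close>

text \<open>A closed walk listed by its distinct vertices. In a graph this is a cycle for
  \<open>m \<ge> 3\<close>, while for \<open>m = 2\<close> a single edge qualifies.\<close>

definition has_cycle :: "('a \<Rightarrow> 'a \<Rightarrow> bool) \<Rightarrow> nat \<Rightarrow> bool" where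
  "has_cycle E m \<longleftrightarrow>
    (\<exists>xs. length xs = m \<and> distinct xs \<and> successively E xs \<and> E (last xs) (hd xs))"

text \<open>Paths carry a direction: for symmetric \<open>E\<close> and \<open>k \<ge> 1\<close>,
  each path appears together with its reversal.\<close>

definition paths :: "'a set \<Rightarrow> ('a \<Rightarrow> 'a \<Rightarrow> bool) \<Rightarrow> nat \<Rightarrow> 'a list set" where
  "paths V E k = {xs. length xs = Suc k \<and> set xs \<subseteq> V \<and> distinct xs \<and> successively E xs}"

locale fin_graph =
  fixes V :: "'a set" and E :: "'a \<Rightarrow> 'a \<Rightarrow> bool"
  assumes fin: "finite V" and sym: "E u v \<Longrightarrow> E v u"
    and in_V: "E u v \<Longrightarrow> u \<in> V" and irrefl: "\<not> E u u"
begin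

abbreviation "nbh u \<equiv> {v. E u v}"

abbreviation "vdeg u \<equiv> card (nbh u)"

text \<open>Ordered pairs are counted, so an edge with both ends in \<open>A\<close> and in
  \<open>B\<close> counts twice.\<close>

definition edge_count :: "'a set \<Rightarrow> 'a set \<Rightarrow> nat" where
  "edge_count A B = (\<Sum>x\<in>A. card {y \<in> B. E x y})"

lemma in_V2: "E u v \<Longrightarrow> v \<in> V"
  using in_V sym by blast

lemma E_commute: "E u v \<longleftrightarrow> E v u"
  using sym by blast

lemma nbh_subset: "nbh u \<subseteq> V"
  using in_V sym by blast

lemma finite_nbh [simp]: "finite (nbh u)"
  using nbh_subset fin by (rule finite_subset)

lemma vdeg_le: "vdeg u \<le> card V"
  using fin nbh_subset by (rule card_mono)

lemma edge_count_commute: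
  assumes "finite A" "finite B"
  shows "edge_count A B = edge_count B A"
proof -
  have *: "card {y \<in> B. E x y} = (\<Sum>y\<in>B. of_bool (E x y))" if "finite B" for x B
    using that by (simp add: of_bool_def sum.If_cases Int_def)
  have "edge_count A B = (\<Sum>x\<in>A. \<Sum>y\<in>B. of_bool (E x y))"
    using assms by (simp add: edge_count_def *)
  also have "\<dots> = (\<Sum>y\<in>B. \<Sum>x\<in>A. of_bool (E x y))"
    by (rule sum.swap)
  also have "\<dots> = (\<Sum>y\<in>B. \<Sum>x\<in>A. of_bool (E y x))"
    by (subst E_commute) (rule refl)
  also have "\<dots> = edge_count B A"
    using assms by (simp add: edge_count_def *)
  finally show ?thesis .
qed

lemma edge_count_remove:
  assumes "finite A" "finite B" "x \<in> A"
  shows "edge_count A B = card {y \<in> B. E x y} + edge_count (A - {x}) B"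
  using assms unfolding edge_count_def by (simp add: sum.remove)

section \<open>Dense cores and greedy paths\<close>

text \<open>The sets \<open>A\<close> and \<open>B\<close> need not be disjoint: the greedy path below avoids all the vertices
  that it has already used, so no passage to a bipartite subgraph is necessary.\<close>

lemma dense_core:
  assumes "finite A" "finite B" "d * (card A + card B) < edge_count A B"
  shows "\<exists>A' B'. A' \<subseteq> A \<and> B' \<subseteq> B \<and> A' \<noteq> {} \<and>
    (\<forall>x\<in>A'. d < card {y \<in> B'. E x y}) \<and> (\<forall>y\<in>B'. d < card {x \<in> A'. E y x})"
  using assms
proof (induction "card A + card B" arbitrary: A B rule: less_induct)
  case less
  note fins = less.prems(1,2)
  \<comment> \<open>Deleting a vertex of degree at most \<open>d\<close> lowers
    \<open>edge_count\<close> by at most \<open>d\<close> and \<open>d * (card A + card B)\<close>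
    by exactly \<open>d\<close>, so the strict inequality survives. If there is no such vertex,
    \<open>A\<close> and \<open>B\<close> form the core.\<close>
  consider x where "x \<in> A" "card {y \<in> B. E x y} \<le> d"
    | y where "y \<in> B" "card {x \<in> A. E y x} \<le> d"
    | "\<forall>x\<in>A. d < card {y \<in> B. E x y}" "\<forall>y\<in>B. d < card {x \<in> A. E y x}"
    by (meson not_le)
  then show ?case
  proof cases
    case 1
    have c: "card A = Suc (card (A - {x}))"
      using 1 fins by (metis card.remove)
    have "d * (card (A - {x}) + card B) < edge_count (A - {x}) B"
      using less.prems(3) edge_count_remove[OF fins 1(1)] 1(2) c by (simp add: algebra_simps)
    then show ?thesis
      using less.hyps[of "A - {x}" B] fins c by (simp add: subset_Diff_insert) blast
  next
    case 2
    have c: "card B = Suc (card (B - {y}))"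
      using 2 fins by (metis card.remove)
    have "d * (card A + card (B - {y})) < edge_count A (B - {y})"
      using less.prems(3) edge_count_remove[OF fins(2,1) 2(1)] 2(2) c fins
      by (simp add: algebra_simps edge_count_commute)
    then show ?thesis
      using less.hyps[of A "B - {y}"] fins c by (simp add: subset_Diff_insert) blast
  next
    case 3
    moreover have "A \<noteq> {}"
      using less.prems(3) by (auto simp: edge_count_def)
    ultimately show ?thesis by blast
  qed
qed

lemma ex_notin_if_card_gt:
  assumes "finite F" "card F < card A"
  shows "\<exists>x\<in>A. x \<notin> F"
  using assms by (metis card_mono leD subsetI)

text \<open>The path alternates between \<open>A\<close> and \<open>B\<close>. Each round moves two
  used vertices into the forbidden set \<open>F\<close> and lowers \<open>j\<close> by one, so
  \<open>card F + 2 * j\<close> does not grow and every degree exceeds the number of forbidden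
  vertices.\<close>

lemma greedy_path:
  assumes A: "\<And>x. x \<in> A \<Longrightarrow> d < card {y \<in> B. E x y}"
    and B: "\<And>y. y \<in> B \<Longrightarrow> d < card {x \<in> A. E y x}"
    and "x \<in> A" "x \<notin> F" "finite F" "card F + 2 * j \<le> d"
  shows "\<exists>xs. length xs = Suc (2 * j) \<and> distinct xs \<and> successively E xs \<and> hd xs = x \<and>
    last xs \<in> A \<and> set xs \<subseteq> (A \<union> B) - F"
  using assms(3-)
proof (induction j arbitrary: x F)
  case 0
  then show ?case by (intro exI[of _ "[x]"]) auto
next
  case (Suc j)
  have "card (insert x F) < card {y \<in> B. E x y}"
    using A[OF Suc.prems(1)] Suc.prems by simp
  from ex_notin_if_card_gt[OF _ this] obtain y where y: "y \<in> B" "E x y" "y \<notin> insert x F"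
    using Suc.prems by auto
  have "card (insert y (insert x F)) < card {x \<in> A. E y x}"
    using B[OF y(1)] y Suc.prems by simp
  from ex_notin_if_card_gt[OF _ this] obtain x' where
    x': "x' \<in> A" "E y x'" "x' \<notin> insert y (insert x F)"
    using Suc.prems by auto
  have "card (insert y (insert x F)) + 2 * j \<le> d"
    using y Suc.prems by simp
  from Suc.IH[OF x'(1,3) _ this] obtain xs where
    xs: "length xs = Suc (2 * j)" "distinct xs" "successively E xs" "hd xs = x'"
    "last xs \<in> A" "set xs \<subseteq> (A \<union> B) - insert y (insert x F)"
    using Suc.prems by auto
  then show ?case
    using y x' Suc.prems
    by (intro exI[of _ "x # y # xs"]) (auto simp: successively_Cons)
qed

text \<open>A greedy path with \<open>2 * l - 1\<close> vertices that avoids \<open>a\<close> has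
  both ends in \<open>A\<close>, and \<open>a\<close> is adjacent to both.\<close>

lemma has_cycle_if_apex:
  assumes "\<And>x. x \<in> A \<Longrightarrow> 2 * l < card {y \<in> B. E x y}"
    and "\<And>y. y \<in> B \<Longrightarrow> 2 * l < card {x \<in> A. E y x}"
    and "A \<noteq> {}" "A \<subseteq> nbh a" "1 \<le> l"
  shows "has_cycle E (2 * l)"
proof -
  obtain x where x: "x \<in> A" using assms by blast
  then have "x \<notin> {a}" using assms irrefl by auto
  moreover have "card {a} + 2 * (l - 1) \<le> 2 * l" using \<open>1 \<le> l\<close> by simp
  ultimately obtain xs where xs: "length xs = Suc (2 * (l - 1))" "distinct xs" "successively E xs"
    "hd xs = x" "last xs \<in> A" "set xs \<subseteq> (A \<union> B) - {a}"
    using greedy_path[of A "2 * l" B x "{a}" "l - 1", OF assms(1,2) x] by auto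
  have "xs \<noteq> []" using xs by auto
  then have "successively E (a # xs)" "E (last (a # xs)) (hd (a # xs))" "distinct (a # xs)"
    using xs x assms(4) by (auto simp: successively_Cons E_commute)
  moreover have "length (a # xs) = 2 * l"
    using xs \<open>1 \<le> l\<close> by simp
  ultimately show ?thesis
    unfolding has_cycle_def by blast
qed

section \<open>Edge and degree sums around a vertex\<close>

lemma edge_count_nbh_le:
  assumes "\<not> has_cycle E (2 * l)" "1 \<le> l" "A \<subseteq> nbh a" "finite B"
  shows "edge_count A B \<le> 2 * l * (card A + card B)"
proof (rule ccontr)
  assume "\<not> ?thesis"
  moreover have "finite A" using assms(3) finite_nbh by (rule finite_subset)
  ultimately obtain A' B' where "A' \<subseteq> A" "A' \<noteq> {}"
    "\<forall>x\<in>A'. 2 * l < card {y \<in> B'. E x y}" "\<forall>y\<in>B'. 2 * l < card {x \<in> A'. E y x}"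
    using dense_core[of A B "2 * l"] assms by (auto simp: not_le)
  then show False
    using has_cycle_if_apex[of A' l B' a] assms by blast
qed

lemma sum_deg_nbh_le:
  assumes "\<not> has_cycle E (2 * l)" "1 \<le> l"
  shows "(\<Sum>b\<in>nbh a. vdeg b) \<le> 4 * l * card V"
proof -
  have "(\<Sum>b\<in>nbh a. vdeg b) = edge_count (nbh a) V"
    unfolding edge_count_def using nbh_subset by (intro sum.cong arg_cong[of _ _ card]) auto
  also have "\<dots> \<le> 2 * l * (vdeg a + card V)"
    using edge_count_nbh_le[OF assms order_refl fin] .
  also have "\<dots> \<le> 2 * l * (card V + card V)"
    using vdeg_le by (intro mult_left_mono) auto
  finally show ?thesis by (simp add: algebra_simps)
qed

text \<open>Every \<open>x\<close> in \<open>A\<close> has a parent \<open>p x\<close> adjacent to \<open>a\<close>. If, in the dense core, the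
  neighbours of each \<open>y\<close> have a common parent, then this parent is an apex for a part of the core.
  Otherwise some \<open>y\<close> has neighbours with two different parents, and one of these differs from the
  parent of the last vertex \<open>z\<close> of a greedy path from \<open>y\<close>; the cycle runs through \<open>a\<close> and the
  two parents.\<close>

lemma edge_count_second_nbh_le:
  assumes free: "\<not> has_cycle E (2 * l)" and "3 \<le> l"
    and A: "\<And>x. x \<in> A \<Longrightarrow> \<exists>b. E a b \<and> E b x" "finite A"
    and B: "finite B" "\<And>v. v \<in> A \<union> B \<Longrightarrow> v \<noteq> a \<and> \<not> E a v"
  shows "edge_count A B \<le> 2 * l * (card A + card B)"
proof (rule ccontr)
  assume "\<not> ?thesis"
  then have "2 * l * (card A + card B) < edge_count A B" by simp
  from dense_core[OF A(2) B(1) this] obtain A' B' where sub: "A' \<subseteq> A" "B' \<subseteq> B" "A' \<noteq> {}"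
    and A': "\<And>x. x \<in> A' \<Longrightarrow> 2 * l < card {y \<in> B'. E x y}"
    and B': "\<And>y. y \<in> B' \<Longrightarrow> 2 * l < card {x \<in> A'. E y x}"
    by blast
  obtain p where p: "\<And>x. x \<in> A \<Longrightarrow> E a (p x) \<and> E (p x) x"
    using A by metis
  show False
  proof (cases "\<forall>y\<in>B'. \<forall>x\<in>A'. \<forall>x'\<in>A'. E y x \<longrightarrow> E y x' \<longrightarrow> p x = p x'")
    case True
    obtain x0 where x0: "x0 \<in> A'" using sub by blast
    \<comment> \<open>Passing to the children of one parent and their neighbours loses no degree: by
      the case assumption all neighbours in \<open>A'\<close> of a vertex of \<open>B''\<close> have
      the parent \<open>p x0\<close>.\<close>
    define A'' where "A'' = {x \<in> A'. p x = p x0}"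
    define B'' where "B'' = {y \<in> B'. \<exists>x\<in>A''. E y x}"
    have "{y \<in> B''. E x y} = {y \<in> B'. E x y}" if "x \<in> A''" for x
      using that by (auto simp: B''_def E_commute)
    moreover have "{x \<in> A''. E y x} = {x \<in> A'. E y x}" if "y \<in> B''" for y
      using that True unfolding B''_def A''_def by fastforce
    moreover have "A'' \<subseteq> nbh (p x0)"
    proof
      fix x assume "x \<in> A''"
      then have "p x = p x0" "x \<in> A" using sub by (auto simp: A''_def)
      then show "x \<in> nbh (p x0)" using p[of x] by simp
    qed
    ultimately have "has_cycle E (2 * l)"
      using A' B' x0 \<open>3 \<le> l\<close>
      by (intro has_cycle_if_apex[of A'' l B'' "p x0"]) (auto simp: A''_def B''_def)
    then show False using free by simp
  next
    case False
    then obtain y x x' where y: "y \<in> B'" "x \<in> A'" "x' \<in> A'" "E y x" "E y x'" "p x \<noteq> p x'"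
      by blast
    have ne: "y \<noteq> x" "y \<noteq> x'" "x \<noteq> x'" using y irrefl by auto
    have "card {y, x, x'} < card {x \<in> A'. E y x}"
      using B'[OF y(1)] ne \<open>3 \<le> l\<close> by simp
    \<comment> \<open>The path starts at a third neighbour of \<open>y\<close> and avoids both
      \<open>x\<close> and \<open>x'\<close>, since either of them may have to serve as
      \<open>w\<close>.\<close>
    from ex_notin_if_card_gt[OF _ this] obtain x1 where
      x1: "x1 \<in> A'" "E y x1" "x1 \<notin> {y, x, x'}" by auto
    have "card {y, x, x'} + 2 * (l - 3) \<le> 2 * l"
      using ne \<open>3 \<le> l\<close> by simp
    then obtain xs where xs: "length xs = Suc (2 * (l - 3))" "distinct xs" "successively E xs"
      "hd xs = x1" "last xs \<in> A'" "set xs \<subseteq> (A' \<union> B') - {y, x, x'}"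
      using greedy_path[of A' "2 * l" B' x1 "{y, x, x'}" "l - 3", OF A' B' x1(1,3)] by auto
    let ?z = "last xs"
    obtain w where w: "w \<in> {x, x'}" "p w \<noteq> p ?z"
      using y(6) by (metis insertCI)
    have "xs \<noteq> []" using xs by auto
    have z: "?z \<in> set xs" "?z \<in> A'" using \<open>xs \<noteq> []\<close> xs by auto
    have w': "w \<in> A'" "w \<notin> set xs" "E y w" "w \<noteq> y" using w y xs ne by auto
    \<comment> \<open>The vertex \<open>a\<close> and its neighbours lie outside \<open>A\<close>
      and \<open>B\<close>, so neither \<open>a\<close> nor the two parents can meet the rest of the
      cycle.\<close>
    have not_a: "a \<notin> insert w (insert y (set xs))"
      using B(2) sub w'(1) y(1) xs(6) by blast
    have not_nbh: "q \<notin> insert w (insert y (set xs))" if "E a q" for q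
      using that B(2) sub w'(1) y(1) xs(6) by blast
    have pw: "E a (p w)" "E (p w) w" "E a (p ?z)" "E (p ?z) ?z"
      using p w'(1) z(2) sub by auto
    \<comment> \<open>With the \<open>2 * l - 5\<close> vertices of \<open>xs\<close> this makes
      \<open>2 * l\<close>; for \<open>l = 3\<close> the path is the single vertex
      \<open>x1\<close>.\<close>
    let ?c = "[a, p w, w, y] @ xs @ [p ?z]"
    have "length ?c = 2 * l" using xs(1) \<open>3 \<le> l\<close> by simp
    moreover have "distinct ?c"
      using not_a not_nbh[OF pw(1)] not_nbh[OF pw(3)] w' w(2) xs(2,6) pw irrefl by auto
    moreover have "successively E ?c"
      using pw(1,2) sym[OF pw(4)] sym[OF w'(3)] xs(3,4) x1(2) \<open>xs \<noteq> []\<close>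
      by (simp add: successively_append_iff successively_Cons)
    moreover have "E (last ?c) (hd ?c)" using sym[OF pw(3)] by simp
    ultimately show False using free unfolding has_cycle_def by blast
  qed
qed

definition codeg :: "'a \<Rightarrow> 'a \<Rightarrow> nat" where
  "codeg a c = card {b. E a b \<and> E b c}"

text \<open>Neighbours of \<open>a\<close> contribute at most \<open>?S\<close>. The other vertices
  \<open>c\<close> are not adjacent to \<open>a\<close>, so their edges lead to
  \<open>nbh a\<close>, which costs \<open>?S\<close> again, or into \<open>?B\<close>, where the
  bound for second neighbourhoods applies. Each of the three parts is at most
  \<open>4 * l * card V\<close>.\<close>

lemma sum_deg_second_nbh_le:
  assumes free: "\<not> has_cycle E (2 * l)" and "3 \<le> l"
  shows "(\<Sum>c | c \<noteq> a \<and> (\<exists>b. E a b \<and> E b c). vdeg c) \<le> 12 * l * card V"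
proof -
  let ?A = "{c \<in> V. c \<noteq> a \<and> \<not> E a c \<and> (\<exists>b. E a b \<and> E b c)}"
  let ?B = "{c \<in> V. c \<noteq> a \<and> \<not> E a c}"
  let ?S = "\<Sum>b\<in>nbh a. vdeg b"
  have S: "?S \<le> 4 * l * card V" using sum_deg_nbh_le[OF free] assms by simp
  have cards: "card ?A \<le> card V" "card ?B \<le> card V"
    using fin by (auto intro: card_mono)
  have "edge_count ?A ?B \<le> 2 * l * (card ?A + card ?B)"
    by (rule edge_count_second_nbh_le[OF assms, of _ a]) (auto simp: fin)
  also have "\<dots> \<le> 2 * l * (card V + card V)"
    using cards by (intro mult_left_mono) auto
  finally have XY: "edge_count ?A ?B \<le> 4 * l * card V" by (simp add: algebra_simps)
  have "edge_count ?A (nbh a) = edge_count (nbh a) ?A"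
    using fin by (intro edge_count_commute) auto
  also have "\<dots> \<le> ?S"
    unfolding edge_count_def by (intro sum_mono card_mono) auto
  finally have XN: "edge_count ?A (nbh a) \<le> ?S" .
  have "vdeg c \<le> card {y \<in> ?B. E c y} + card {y \<in> nbh a. E c y}" if "c \<in> ?A" for c
  proof -
    have "nbh c \<subseteq> {y \<in> ?B. E c y} \<union> {y \<in> nbh a. E c y}"
    proof
      fix y assume "y \<in> nbh c"
      then have "E c y" "y \<in> V" "y \<noteq> a" using that in_V sym by auto
      then show "y \<in> {y \<in> ?B. E c y} \<union> {y \<in> nbh a. E c y}" by auto
    qed
    then have "vdeg c \<le> card ({y \<in> ?B. E c y} \<union> {y \<in> nbh a. E c y})"
      by (intro card_mono) (auto simp: fin)
    then show ?thesis using card_Un_le order_trans by blast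
  qed
  then have "(\<Sum>c\<in>?A. vdeg c) \<le> (\<Sum>c\<in>?A. card {y \<in> ?B. E c y} + card {y \<in> nbh a. E c y})"
    by (rule sum_mono)
  also have "\<dots> = edge_count ?A ?B + edge_count ?A (nbh a)"
    unfolding edge_count_def by (rule sum.distrib)
  finally have A: "(\<Sum>c\<in>?A. vdeg c) \<le> 4 * l * card V + ?S" using XY XN by simp
  have "(\<Sum>c | c \<noteq> a \<and> (\<exists>b. E a b \<and> E b c). vdeg c) \<le> (\<Sum>c\<in>?A \<union> nbh a. vdeg c)"
    by (intro sum_mono2) (auto simp: fin intro: in_V sym)
  also have "\<dots> \<le> (\<Sum>c\<in>?A. vdeg c) + ?S"
    using fin by (subst sum.union_disjoint) auto
  finally show ?thesis using A S by simp
qed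

lemma sum_deg_squares: "(\<Sum>c\<in>V. vdeg c * vdeg c) = (\<Sum>a\<in>V. \<Sum>c\<in>nbh a. vdeg c)"
proof -
  have nbh_V: "{a. a \<in> V \<and> E a c} = nbh c" for c
    using in_V sym by blast
  have "(\<Sum>c\<in>V. vdeg c * vdeg c) = (\<Sum>c\<in>V. \<Sum>a | a \<in> V \<and> E a c. vdeg c)"
    using nbh_V by simp
  also have "\<dots> = (\<Sum>a\<in>V. \<Sum>c | c \<in> V \<and> E a c. vdeg c)"
    by (rule sum.swap_restrict[OF fin fin])
  also have "\<dots> = (\<Sum>a\<in>V. \<Sum>c\<in>nbh a. vdeg c)"
    using nbh_subset by (intro sum.cong refl) auto
  finally show ?thesis .
qed

lemma sum_deg_squares_le:
  assumes "\<not> has_cycle E (2 * l)" "1 \<le> l"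
  shows "(\<Sum>c\<in>V. vdeg c * vdeg c) \<le> 4 * l * card V * card V"
proof -
  have "(\<Sum>a\<in>V. \<Sum>c\<in>nbh a. vdeg c) \<le> (\<Sum>a\<in>V. 4 * l * card V)"
    using sum_deg_nbh_le[OF assms] by (intro sum_mono) auto
  then show ?thesis unfolding sum_deg_squares by (simp add: mult_ac)
qed

text \<open>The edge bound has an error term \<open>2 * l * card T\<close>. Each summand exceeds
  \<open>4 * l\<close>, so this term is at most half of the sum and can be absorbed.\<close>

lemma sum_large_codeg_le:
  assumes "\<not> has_cycle E (2 * l)" "1 \<le> l" "T = {a \<in> V. a \<noteq> c \<and> 4 * l < codeg a c}"
  shows "(\<Sum>a\<in>T. codeg a c) \<le> 4 * l * vdeg c"
proof -
  have T: "finite T" using fin assms by simp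
  have "(\<Sum>a\<in>T. codeg a c) = edge_count T (nbh c)"
    unfolding edge_count_def codeg_def
    by (intro sum.cong arg_cong[of _ _ card]) (auto simp: E_commute)
  also have "\<dots> = edge_count (nbh c) T"
    using T by (intro edge_count_commute) auto
  also have "\<dots> \<le> 2 * l * (vdeg c + card T)"
    by (rule edge_count_nbh_le[OF assms(1,2) order_refl T])
  finally have 1: "(\<Sum>a\<in>T. codeg a c) \<le> 2 * l * (vdeg c + card T)" .
  have "(\<Sum>a\<in>T. 4 * l) \<le> (\<Sum>a\<in>T. codeg a c)"
    using assms by (intro sum_mono) auto
  then show ?thesis using 1 by (simp add: algebra_simps)
qed

section \<open>Counting paths two edges at a time\<close>

lemma finite_paths: "finite (paths V E k)"
  by (rule finite_subset[OF _ finite_lists_length_eq[OF fin, of "Suc k"]])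
    (auto simp: paths_def)

lemma card_paths_0: "card (paths V E 0) = card V"
proof -
  have "paths V E 0 = (\<lambda>v. [v]) ` V"
    by (auto simp: paths_def length_Suc_conv)
  then show ?thesis by (simp add: card_image inj_on_def)
qed

lemma card_paths_1: "card (paths V E 1) = (\<Sum>u\<in>V. vdeg u)"
proof -
  have "paths V E 1 = (\<lambda>(u, v). [u, v]) ` (SIGMA u:V. nbh u)"
    using in_V sym irrefl by (fastforce simp: paths_def length_Suc_conv image_iff)
  then show ?thesis
    by (simp add: card_image inj_on_def fin split_def)
qed

text \<open>Removing the first two vertices of a path leaves a path with \<open>k\<close> edges, and
  the removed part is a walk of two edges from its head. Excluding \<open>v = u\<close> lets
  \<open>M\<close> be \<open>card V\<close> when there are no four-cycles.\<close>

lemma card_paths_add_two_le: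
  assumes "\<And>u. card {(w, v). E u w \<and> E w v \<and> v \<noteq> u} \<le> M"
  shows "card (paths V E (k + 2)) \<le> M * card (paths V E k)"
proof -
  let ?W = "\<lambda>u. {(w, v). E u w \<and> E w v \<and> v \<noteq> u}"
  have W: "finite (?W u)" for u
    by (rule finite_subset[of _ "V \<times> V"]) (auto simp: fin intro: in_V in_V2)
  let ?S = "SIGMA xs:paths V E k. ?W (hd xs)"
  have "paths V E (k + 2) \<subseteq> (\<lambda>(xs, w, v). v # w # xs) ` ?S"
  proof
    fix ys assume ys: "ys \<in> paths V E (k + 2)"
    then obtain v w u us where "ys = v # w # u # us"
      by (auto simp: paths_def length_Suc_conv)
    with ys show "ys \<in> (\<lambda>(xs, w, v). v # w # xs) ` ?S"
      by (intro image_eqI[of _ _ "(u # us, w, v)"]) (auto simp: paths_def intro: sym)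
  qed
  then have "card (paths V E (k + 2)) \<le> card ?S"
    using finite_paths W by (intro surj_card_le) auto
  also have "\<dots> = (\<Sum>xs\<in>paths V E k. card (?W (hd xs)))"
    using finite_paths W by simp
  also have "\<dots> \<le> (\<Sum>xs\<in>paths V E k. M)"
    using assms by (rule sum_mono)
  finally show ?thesis by (simp add: mult.commute)
qed

lemma card_two_walks_le:
  assumes "\<not> has_cycle E (2 * l)" "1 \<le> l"
  shows "card {(w, v). E u w \<and> E w v \<and> v \<noteq> u} \<le> 4 * l * card V"
proof -
  have "card {(w, v). E u w \<and> E w v \<and> v \<noteq> u} \<le> card (SIGMA w:nbh u. nbh w)"
    by (intro card_mono finite_SigmaI) auto
  also have "\<dots> = (\<Sum>w\<in>nbh u. vdeg w)" by simp
  finally show ?thesis using sum_deg_nbh_le[OF assms, of u] by simp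
qed

lemma card_paths_3_le:
  assumes free: "\<not> has_cycle E (2 * l)" and "3 \<le> l"
  shows "card (paths V E 3) \<le> 64 * l ^ 2 * card V ^ 2"
proof -
  let ?n = "card V"
  have l: "1 \<le> l" using \<open>3 \<le> l\<close> by simp
  \<comment> \<open>A path \<open>a b c d\<close> is chosen by first fixing \<open>c\<close> and
    \<open>a\<close>; then there are \<open>codeg a c\<close> choices for \<open>b\<close> and at
    most \<open>vdeg c\<close> for \<open>d\<close>.\<close>
  let ?S = "SIGMA c:V. SIGMA a:V - {c}. {b. E a b \<and> E b c} \<times> nbh c"
  let ?T = "\<lambda>c. {a \<in> V. a \<noteq> c \<and> 4 * l < codeg a c}"
  let ?P = "\<lambda>c. {a \<in> V. a \<noteq> c \<and> (\<exists>b. E a b \<and> E b c)}"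
  have "paths V E 3 \<subseteq> (\<lambda>(c, a, b, d). [a, b, c, d]) ` ?S"
  proof
    fix xs assume xs: "xs \<in> paths V E 3"
    then obtain a b c d where "xs = [a, b, c, d]"
      by (auto simp: paths_def length_Suc_conv numeral_3_eq_3)
    with xs show "xs \<in> (\<lambda>(c, a, b, d). [a, b, c, d]) ` ?S"
      by (intro image_eqI[of _ _ "(c, a, b, d)"]) (auto simp: paths_def)
  qed
  then have "card (paths V E 3) \<le> card ?S"
    using fin by (intro surj_card_le) auto
  also have "\<dots> = (\<Sum>c\<in>V. \<Sum>a\<in>V - {c}. codeg a c * vdeg c)"
    using fin by (simp add: codeg_def card_cartesian_product)
  also have "\<dots> \<le> (\<Sum>c\<in>V. 4 * l * (vdeg c * vdeg c) + (\<Sum>a\<in>?P c. 4 * l * vdeg c))"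
  proof (rule sum_mono)
    fix c
    have P: "finite (?P c)" using fin by simp
    have "(\<Sum>a\<in>V - {c} - ?T c. codeg a c * vdeg c) = (\<Sum>a\<in>?P c - ?T c. codeg a c * vdeg c)"
      using fin by (intro sum.mono_neutral_right) (auto simp: codeg_def)
    also have "\<dots> \<le> (\<Sum>a\<in>?P c - ?T c. 4 * l * vdeg c)"
      by (intro sum_mono mult_right_mono) auto
    also have "\<dots> \<le> (\<Sum>a\<in>?P c. 4 * l * vdeg c)"
      by (rule sum_mono2[OF P]) (rule Diff_subset, rule le0)
    finally have small: "(\<Sum>a\<in>V - {c} - ?T c. codeg a c * vdeg c) \<le> \<dots>" .
    have "(\<Sum>a\<in>?T c. codeg a c * vdeg c) = (\<Sum>a\<in>?T c. codeg a c) * vdeg c"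
      by (rule sum_distrib_right[symmetric])
    also have "\<dots> \<le> 4 * l * vdeg c * vdeg c"
      by (rule mult_right_mono[OF sum_large_codeg_le[OF free l refl] le0])
    finally have large: "(\<Sum>a\<in>?T c. codeg a c * vdeg c) \<le> 4 * l * (vdeg c * vdeg c)"
      by (simp only: mult.assoc)
    have "(\<Sum>a\<in>V - {c}. codeg a c * vdeg c) =
        (\<Sum>a\<in>V - {c} - ?T c. codeg a c * vdeg c) + (\<Sum>a\<in>?T c. codeg a c * vdeg c)"
      using fin by (intro sum.subset_diff) auto
    then show "(\<Sum>a\<in>V - {c}. codeg a c * vdeg c) \<le>
        4 * l * (vdeg c * vdeg c) + (\<Sum>a\<in>?P c. 4 * l * vdeg c)"
      using add_mono[OF large small] by (simp only: add.commute)
  qed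
  also have "\<dots> = 4 * l * (\<Sum>c\<in>V. vdeg c * vdeg c) + (\<Sum>c\<in>V. \<Sum>a\<in>?P c. 4 * l * vdeg c)"
    by (simp only: sum.distrib sum_distrib_left)
  \<comment> \<open>With \<open>a\<close> outermost, the inner sum runs over the degrees of the
    vertices reached from \<open>a\<close> by two edges, which is the sum bounded above.\<close>
  also have "(\<Sum>c\<in>V. \<Sum>a\<in>?P c. 4 * l * vdeg c) =
      (\<Sum>a\<in>V. \<Sum>c | c \<in> V \<and> a \<noteq> c \<and> (\<exists>b. E a b \<and> E b c). 4 * l * vdeg c)"
    by (rule sum.swap_restrict[OF fin fin])
  also have "\<dots> = (\<Sum>a\<in>V. 4 * l * (\<Sum>c | c \<noteq> a \<and> (\<exists>b. E a b \<and> E b c). vdeg c))"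
    unfolding sum_distrib_left by (intro sum.cong refl) (auto intro: in_V2)
  also have "4 * l * (\<Sum>c\<in>V. vdeg c * vdeg c) + \<dots> \<le>
      4 * l * (4 * l * ?n * ?n) + (\<Sum>a\<in>V. 4 * l * (12 * l * ?n))"
    using sum_deg_squares_le[OF free l] sum_deg_second_nbh_le[OF assms]
    by (intro add_mono sum_mono mult_left_mono le0)
  also have "\<dots> = 64 * l ^ 2 * ?n ^ 2"
    by (simp add: power2_eq_square)
  finally show ?thesis .
qed

text \<open>Induction in steps of two from \<open>k = 2\<close> and \<open>k = 3\<close>. Odd
  \<open>k\<close> cannot start from \<open>k = 1\<close>, where the formula would be linear in
  \<open>card V\<close>.\<close>

lemma card_paths_le:
  assumes free: "\<not> has_cycle E (2 * l)" and "3 \<le> l" "2 \<le> k"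
  shows "card (paths V E k) \<le> 64 ^ k * l ^ ((k + 1) div 2) * card V ^ ((k + 2) div 2)"
  using \<open>2 \<le> k\<close>
proof (induction k rule: less_induct)
  case (less k)
  let ?n = "card V"
  have l: "1 \<le> l" using \<open>3 \<le> l\<close> by simp
  have step: "card (paths V E (j + 2)) \<le> 4 * l * ?n * card (paths V E j)" for j
    by (rule card_paths_add_two_le) (rule card_two_walks_le[OF free l])
  consider "k = 2" | "k = 3" | j where "k = j + 2" "2 \<le> j"
  proof (cases "k = 2 \<or> k = 3")
    case False
    then have "k = (k - 2) + 2" "2 \<le> k - 2" using less.prems by auto
    then show ?thesis using that(3) by blast
  qed (use that in auto)
  then show ?case
  proof cases
    case 1
    have "card (paths V E 2) \<le> 4 * l * ?n * ?n"
      using step[of 0] unfolding card_paths_0 add_0 .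
    then show ?thesis using 1
      by (simp add: power2_eq_square algebra_simps)
  next
    case 2
    then show ?thesis using card_paths_3_le[OF assms(1,2)] by (simp add: algebra_simps)
  next
    case 3
    have "card (paths V E k) \<le> 4 * l * ?n * card (paths V E j)"
      using step[of j] 3 by simp
    also have "\<dots> \<le> 4 * l * ?n * (64 ^ j * l ^ ((j + 1) div 2) * ?n ^ ((j + 2) div 2))"
      using less.IH[of j] 3 by (intro mult_left_mono) auto
    also have "\<dots> = 4 * (64 ^ j * l ^ ((k + 1) div 2) * ?n ^ ((k + 2) div 2))"
      using 3 by simp
    also have "\<dots> \<le> 64 ^ k * l ^ ((k + 1) div 2) * ?n ^ ((k + 2) div 2)"
      using 3 by simp
    finally show ?thesis .
  qed
qed

section \<open>Path counts without four-cycles\<close>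

lemma card_two_walks_le_if_C4_free:
  assumes "\<not> has_cycle E 4"
  shows "card {(w, v). E u w \<and> E w v \<and> v \<noteq> u} \<le> card V"
proof (rule card_inj_on_le[of snd])
  \<comment> \<open>Two walks with the same ends but different middle vertices form a four-cycle, so
    a walk is determined by its end.\<close>
  have "w = w'" if "E u w" "E w v" "v \<noteq> u" "E u w'" "E w' v" for v w w'
  proof (rule ccontr)
    assume "w \<noteq> w'"
    then have "distinct [u, w, v, w']" using that irrefl by auto
    moreover have "successively E [u, w, v, w']" "E (last [u, w, v, w']) (hd [u, w, v, w'])"
      using that sym by auto
    moreover have "length [u, w, v, w'] = 4" by simp
    ultimately show False using assms unfolding has_cycle_def by blast
  qed
  then show "inj_on snd {(w, v). E u w \<and> E w v \<and> v \<noteq> u}"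
    unfolding inj_on_def by auto
  show "snd ` {(w, v). E u w \<and> E w v \<and> v \<noteq> u} \<subseteq> V"
    by (auto intro: in_V in_V2)
qed (rule fin)

text \<open>Counting walks of two edges bounds the sum of the squared degrees. Instead of the
  Cauchy-Schwarz inequality, \<open>2 * s * d \<le> s^2 + d^2\<close> is summed over all degrees
  \<open>d\<close>, with \<open>s\<close> the square root of the number of vertices.\<close>

lemma card_paths_1_le_if_C4_free:
  assumes "\<not> has_cycle E 4"
  shows "real (card (paths V E 1)) \<le> 2 * real (card V) powr (3 / 2)"
proof -
  let ?n = "real (card V)" and ?D = "real (\<Sum>u\<in>V. vdeg u)"
  define s where "s = sqrt ?n"
  have n: "?n = s\<^sup>2" and "0 \<le> s" by (simp_all add: s_def)
  \<comment> \<open>The term \<open>vdeg u\<close> accounts for the walks that return to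
    \<open>u\<close>.\<close>
  have "(\<Sum>w\<in>nbh u. vdeg w) \<le> card V + vdeg u" for u
  proof -
    let ?W = "{(w, v). E u w \<and> E w v \<and> v \<noteq> u}"
    have "finite ?W"
      by (rule finite_subset[of _ "V \<times> V"]) (auto simp: fin intro: in_V in_V2)
    have "(\<Sum>w\<in>nbh u. vdeg w) = card (SIGMA w:nbh u. nbh w)" by simp
    also have "\<dots> \<le> card (?W \<union> (\<lambda>w. (w, u)) ` nbh u)"
      using \<open>finite ?W\<close> by (intro card_mono) auto
    also have "\<dots> \<le> card ?W + card ((\<lambda>w. (w, u)) ` nbh u)"
      by (rule card_Un_le)
    also have "\<dots> \<le> card V + vdeg u"
      using card_two_walks_le_if_C4_free[OF assms] card_image_le[OF finite_nbh]
      by (intro add_mono)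
    finally show ?thesis .
  qed
  then have "(\<Sum>c\<in>V. vdeg c * vdeg c) \<le> (\<Sum>u\<in>V. card V + vdeg u)"
    unfolding sum_deg_squares by (intro sum_mono)
  then have "real (\<Sum>c\<in>V. vdeg c * vdeg c) \<le> real (\<Sum>u\<in>V. card V + vdeg u)"
    by (rule of_nat_mono)
  then have sq: "(\<Sum>u\<in>V. (real (vdeg u))\<^sup>2) \<le> ?n\<^sup>2 + ?D"
    by (simp add: sum.distrib power2_eq_square)
  have "2 * s * ?D = (\<Sum>u\<in>V. 2 * s * real (vdeg u))"
    by (simp add: sum_distrib_left)
  also have "\<dots> \<le> (\<Sum>u\<in>V. s\<^sup>2 + (real (vdeg u))\<^sup>2)"
    by (intro sum_mono sum_squares_bound)
  also have "\<dots> = ?n * s\<^sup>2 + (\<Sum>u\<in>V. (real (vdeg u))\<^sup>2)"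
    by (simp add: sum.distrib)
  also have "\<dots> \<le> 2 * s ^ 4 + ?D"
    using sq by (simp add: n flip: power_add power_mult)
  finally have D: "2 * s * ?D \<le> 2 * s ^ 4 + ?D" .
  have "?D \<le> 2 * s ^ 3"
  proof (cases "card V = 0")
    case False
    then have "1 \<le> s" by (simp add: s_def)
    then have "1 * ?D \<le> s * ?D" by (rule mult_right_mono) (rule of_nat_0_le_iff)
    with D have "s * ?D \<le> s * (2 * s ^ 3)"
      by (simp add: power3_eq_cube power4_eq_xxxx)
    then show ?thesis using \<open>1 \<le> s\<close> by simp
  qed (simp add: s_def fin)
  also have "s ^ 3 = ?n powr (3 / 2)"
  proof -
    have "s ^ 3 = s powr 3" using \<open>0 \<le> s\<close> by (simp add: powr_numeral)
    also have "\<dots> = ?n powr (3 / 2)" by (simp add: s_def powr_half_sqrt[symmetric] powr_powr)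
    finally show ?thesis .
  qed
  finally show ?thesis unfolding card_paths_1 by simp
qed

lemma card_paths_le_if_C4_free:
  assumes free: "\<not> has_cycle E 4"
  shows "real (card (paths V E k)) \<le> 2 * real (card V) powr (real k / 2 + 1)"
proof (induction k rule: less_induct)
  case (less k)
  consider "k = 0" | "k = 1" | j where "k = j + 2"
  proof (cases "k < 2")
    case False
    then have "k = (k - 2) + 2" by simp
    then show ?thesis by (rule that(3))
  qed (use that in fastforce)
  then show ?case
  proof cases
    case 1
    then show ?thesis by (simp add: card_paths_0)
  next
    case 2
    then show ?thesis using card_paths_1_le_if_C4_free[OF free] by (simp add: add.commute)
  next
    case 3
    let ?n = "real (card V)"
    have "card (paths V E (j + 2)) \<le> card V * card (paths V E j)"
      by (rule card_paths_add_two_le) (rule card_two_walks_le_if_C4_free[OF free])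
    then have "real (card (paths V E k)) \<le> real (card V * card (paths V E j))"
      unfolding 3 by (rule of_nat_mono)
    also have "\<dots> = ?n * card (paths V E j)" by simp
    also have "\<dots> \<le> ?n * (2 * ?n powr (real j / 2 + 1))"
      using less.IH[of j] 3 by (intro mult_left_mono) auto
    also have "\<dots> = 2 * (?n powr 1 * ?n powr (real j / 2 + 1))" by simp
    also have "\<dots> = 2 * ?n powr (real k / 2 + 1)"
      unfolding 3 by (subst powr_add[symmetric]) (simp add: field_simps)
    finally show ?thesis .
  qed
qed

end

section \<open>Copies of paths and cycles\<close>

definition adj :: "'a sgraph \<Rightarrow> 'a \<Rightarrow> 'a \<Rightarrow> bool" where
  "adj G u v \<longleftrightarrow> {u, v} \<in> edges G"

lemma fin_graph_adj:
  assumes "simple_graph G"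
  shows "fin_graph (verts G) (adj G)"
proof
  have *: "u \<in> verts G \<and> u \<noteq> v" if "adj G u v" for u v
  proof -
    have "{u, v} \<in> [verts G]\<^bsup>2\<^esup>"
      using that assms unfolding adj_def simple_graph_def by (rule_tac subsetD) simp_all
    then show ?thesis by simp
  qed
  show "finite (verts G)"
    using assms by (simp add: simple_graph_def)
  show "adj G v u" if "adj G u v" for u v
    using that by (simp add: adj_def insert_commute)
  show "u \<in> verts G" if "adj G u v" for u v
    using *[OF that] by simp
  show "\<not> adj G u u" for u
    using *[of u u] by blast
qed

text \<open>Computes the image of the edge set of a path or cycle under a vertex map.\<close>

lemma image_doubletons:
  "(\<lambda>e. f ` e) ` {{g i, h i} | i. P i} = {{f (g i), f (h i)} | i. P i}"
  by (simp add: setcompr_eq_image image_image)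

definition path_of :: "'a list \<Rightarrow> 'a sgraph" where
  "path_of xs = (set xs, {{xs ! i, xs ! Suc i} | i. Suc i < length xs})"

text \<open>The values of an isomorphism, read in order, form a list of vertices; conversely,
  indexing into such a list is an isomorphism.\<close>

lemma copies_path_graph:
  assumes "simple_graph G"
  shows "copies (path_graph k) G = path_of ` paths (verts G) (adj G) k"
proof (intro equalityI subsetI)
  fix S assume "S \<in> copies (path_graph k) G"
  then obtain f where f: "bij_betw f {0..k} (verts S)"
      "edges S = (\<lambda>e. f ` e) ` {{i, Suc i} | i. i < k}" and S: "subgraph S G"
    by (auto simp: copies_def graph_iso_def path_graph_def)
  let ?xs = "map f [0..<Suc k]"
  have nth: "?xs ! i = f i" if "i < Suc k" for i
    using that by (metis add_0 diff_zero length_upt nth_map nth_upt)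
  have set: "set ?xs = verts S"
    using f(1) by (simp only: set_map atLeast_upt[symmetric] atLeast0AtMost lessThan_Suc_atMost bij_betw_def)
  have edges: "edges S = {{f i, f (Suc i)} | i. i < k}"
    unfolding f(2) by (rule image_doubletons)
  also have "\<dots> = {{?xs ! i, ?xs ! Suc i} | i. Suc i < length ?xs}"
  proof -
    have "{f i, f (Suc i)} = {?xs ! i, ?xs ! Suc i}" if "i < k" for i
      using nth[of i] nth[of "Suc i"] that by simp
    then show ?thesis
      by (intro Collect_cong ex_cong1) (auto simp del: upt_Suc)
  qed
  finally have "S = path_of ?xs"
    using set by (simp add: path_of_def prod_eq_iff del: upt_Suc)
  moreover have "?xs \<in> paths (verts G) (adj G) k"
  proof -
    have "successively (adj G) ?xs"
      unfolding successively_conv_nth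
    proof (intro allI impI)
      fix i assume "Suc i < length ?xs"
      then have "{f i, f (Suc i)} \<in> edges S" "?xs ! i = f i" "?xs ! Suc i = f (Suc i)"
        using nth by (auto simp: edges simp del: upt_Suc)
      then show "adj G (?xs ! i) (?xs ! Suc i)"
        using S by (auto simp: adj_def subgraph_def)
    qed
    moreover have "distinct ?xs"
      using f(1) by (auto simp: distinct_map bij_betw_def atLeast0AtMost lessThan_Suc_atMost
          atLeast0LessThan simp del: upt_Suc)
    ultimately show ?thesis
      using set S by (simp add: paths_def subgraph_def del: upt_Suc)
  qed
  ultimately show "S \<in> path_of ` paths (verts G) (adj G) k" by blast
next
  fix S assume "S \<in> path_of ` paths (verts G) (adj G) k"
  then obtain xs where xs: "length xs = Suc k" "set xs \<subseteq> verts G" "distinct xs"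
      "successively (adj G) xs" and S: "S = path_of xs"
    by (auto simp: paths_def)
  have "edges S \<subseteq> edges G"
    using xs(4) by (auto simp: S path_of_def successively_conv_nth adj_def)
  moreover have "simple_graph S"
    using xs by (auto simp: simple_graph_def S path_of_def nth_eq_iff_index_eq)
  moreover have "bij_betw ((!) xs) {0..k} (verts S)"
    using bij_betw_nth[OF xs(3), of "{..<length xs}" "set xs"] xs(1)
    by (simp add: S path_of_def atLeast0AtMost lessThan_Suc_atMost)
  moreover have "edges S = (\<lambda>e. (!) xs ` e) ` {{i, Suc i} | i. i < k}"
    unfolding image_doubletons using xs(1) by (simp add: S path_of_def)
  ultimately show "S \<in> copies (path_graph k) G"
    using xs(2) unfolding copies_def subgraph_def graph_iso_def
    by (auto simp: path_graph_def S path_of_def)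
qed

lemma card_copies_path_le:
  assumes "simple_graph G"
  shows "card (copies (path_graph k) G) \<le> card (paths (verts G) (adj G) k)"
  unfolding copies_path_graph[OF assms]
  by (rule card_image_le) (rule fin_graph.finite_paths[OF fin_graph_adj[OF assms]])

text \<open>A copy has \<open>Suc k\<close> vertices, so at most \<open>Suc k ^ Suc k\<close> lists
  can produce it. This crude factor depends only on \<open>k\<close>.\<close>

lemma card_paths_le_copies:
  assumes "simple_graph G"
  shows "card (paths (verts G) (adj G) k) \<le> Suc k ^ Suc k * card (copies (path_graph k) G)"
proof -
  let ?P = "paths (verts G) (adj G) k" and ?C = "copies (path_graph k) G"
  let ?F = "\<lambda>S. {xs. set xs \<subseteq> verts S \<and> length xs = Suc k}"
  have P: "finite ?P" by (rule fin_graph.finite_paths[OF fin_graph_adj[OF assms]])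
  have S: "finite (verts S) \<and> card (verts S) = Suc k" if "S \<in> ?C" for S
    using that unfolding copies_path_graph[OF assms]
    by (auto simp: path_of_def paths_def distinct_card)
  have "?P \<subseteq> (\<Union>S\<in>?C. ?F S)"
    unfolding copies_path_graph[OF assms] by (auto simp: path_of_def paths_def)
  moreover have C: "finite ?C"
    using P unfolding copies_path_graph[OF assms] by simp
  ultimately have "card ?P \<le> card (\<Union>S\<in>?C. ?F S)"
    using S by (intro card_mono finite_UN_I finite_lists_length_eq) auto
  also have "\<dots> \<le> (\<Sum>S\<in>?C. card (?F S))"
    using C by (rule card_UN_le)
  also have "\<dots> = (\<Sum>S\<in>?C. Suc k ^ Suc k)"
    using S by (intro sum.cong refl) (simp add: card_lists_length_eq)
  finally show ?thesis by (simp add: mult.commute)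
qed

text \<open>In the periodic form the closing edge is no special case and the starting point can be
  shifted freely.\<close>

lemma has_cycle_iff_periodic:
  assumes "1 \<le> m"
  shows "has_cycle E m \<longleftrightarrow>
    (\<exists>c. (\<forall>i. E (c i) (c (Suc i))) \<and> (\<forall>i j. c i = c j \<longleftrightarrow> i mod m = j mod m))"
    (is "_ \<longleftrightarrow> (\<exists>c. ?P c)")
proof
  assume "has_cycle E m"
  then obtain xs where xs: "length xs = m" "distinct xs" "successively E xs" "E (last xs) (hd xs)"
    by (auto simp: has_cycle_def)
  let ?c = "\<lambda>i. xs ! (i mod m)"
  have "E (?c i) (?c (Suc i))" for i
  proof (cases "Suc (i mod m) = m")
    case True
    then have "i mod m = length xs - 1" using xs(1) by simp
    moreover have "xs \<noteq> []" using xs(1) assms by auto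
    moreover have "Suc i mod m = 0" using True by (simp add: mod_Suc)
    ultimately show ?thesis
      using xs(4) by (simp add: last_conv_nth hd_conv_nth)
  next
    case False
    then have "Suc (i mod m) < m" using assms by (simp add: Suc_lessI)
    then show ?thesis
      using xs(1,3) False by (simp add: mod_Suc successively_conv_nth)
  qed
  then show "\<exists>c. ?P c"
    using xs(1,2) assms by (intro exI[of _ ?c]) (auto simp: nth_eq_iff_index_eq)
next
  assume "\<exists>c. ?P c"
  then obtain c where c: "\<And>i. E (c i) (c (Suc i))" "\<And>i j. c i = c j \<longleftrightarrow> i mod m = j mod m"
    by blast
  let ?xs = "map c [0..<m]"
  have "distinct ?xs"
    using c(2) by (auto simp: distinct_map inj_on_def)
  moreover have "successively E ?xs"
    using c(1) by (simp add: successively_conv_nth)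
  moreover have "E (last ?xs) (hd ?xs)"
  proof -
    have "last ?xs = c (m - 1)" "hd ?xs = c 0"
      using assms by (simp_all add: last_map hd_map)
    moreover have "c (Suc (m - 1)) = c 0" using c(2) assms by simp
    ultimately show ?thesis using c(1)[of "m - 1"] by simp
  qed
  ultimately show "has_cycle E m"
    unfolding has_cycle_def by (intro exI[of _ ?xs]) simp
qed

lemma copies_cycle_graph_empty_iff:
  assumes G: "simple_graph G" and "2 \<le> m"
  shows "copies (cycle_graph m) G = {} \<longleftrightarrow> \<not> has_cycle (adj G) m"
proof -
  have "copies (cycle_graph m) G \<noteq> {}" if cyc: "has_cycle (adj G) m"
  proof -
    have m: "1 \<le> m" using \<open>2 \<le> m\<close> by simp
    obtain c where c: "\<And>i. adj G (c i) (c (Suc i))" "\<And>i j. c i = c j \<longleftrightarrow> i mod m = j mod m"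
      using cyc unfolding has_cycle_iff_periodic[OF m] by blast
    have V: "c i \<in> verts G" "c i \<noteq> c (Suc i)" for i
      using fin_graph.in_V[OF fin_graph_adj[OF G] c(1)]
        fin_graph.irrefl[OF fin_graph_adj[OF G]] c(1)[of i] by auto
    have mod: "c (Suc i mod m) = c (Suc i)" for i
      using c(2) by simp
    define S where "S = (c ` {0..<m}, {{c i, c (Suc i)} | i. i < m})"
    have "c (Suc i) \<in> c ` {0..<m}" for i
      using mod[of i] assms by (metis atLeastLessThan_iff imageI mod_less_divisor less_le_trans zero_le zero_less_numeral)
    then have "simple_graph S"
      using V(2) by (auto simp: S_def simple_graph_def)
    then have "subgraph S G"
      using V(1) c(1) by (auto simp: S_def subgraph_def adj_def)
    moreover have "bij_betw c {0..<m} (verts S)"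
      using c(2) by (auto simp: S_def bij_betw_def inj_on_def)
    moreover have "edges S = (\<lambda>e. c ` e) ` {{i, Suc i mod m} | i. i < m}"
      unfolding image_doubletons mod by (simp add: S_def)
    ultimately have "S \<in> copies (cycle_graph m) G"
      unfolding copies_def graph_iso_def cycle_graph_def by auto
    then show ?thesis by blast
  qed
  moreover have "has_cycle (adj G) m" if copy: "S \<in> copies (cycle_graph m) G" for S
  proof -
    obtain f where f: "bij_betw f {0..<m} (verts S)"
      "edges S = (\<lambda>e. f ` e) ` {{i, Suc i mod m} | i. i < m}" and S: "subgraph S G"
      using copy by (auto simp: copies_def graph_iso_def cycle_graph_def)
    have "adj G (f (i mod m)) (f (Suc i mod m))" for i
    proof -
      have "i mod m < m" using assms by simp
      then have "{f (i mod m), f (Suc (i mod m) mod m)} \<in> edges S"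
        unfolding f(2) image_doubletons by blast
      then show ?thesis
        using S by (auto simp: adj_def subgraph_def mod_Suc_eq)
    qed
    moreover have "f (i mod m) = f (j mod m) \<longleftrightarrow> i mod m = j mod m" for i j
      using f(1) assms by (auto simp: bij_betw_def inj_on_eq_iff)
    moreover have "1 \<le> m" using assms by simp
    ultimately show ?thesis
      unfolding has_cycle_iff_periodic[OF \<open>1 \<le> m\<close>] by (intro exI[of _ "\<lambda>i. f (i mod m)"]) simp
  qed
  ultimately show ?thesis by blast
qed

lemma edges_cycle_graph_nonempty: "1 \<le> m \<Longrightarrow> edges (cycle_graph m) \<noteq> {}"
  by (auto simp: cycle_graph_def intro: exI[of _ 0])

section \<open>Transfer of path counts to \<open>gen_turan\<close>\<close>

lemma gen_turan_le:
  assumes "2 \<le> m"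
    and "\<And>V E. fin_graph (V :: nat set) E \<Longrightarrow> card V = n \<Longrightarrow> \<not> has_cycle E m \<Longrightarrow>
      card (paths V E k) \<le> B"
  shows "gen_turan n (path_graph k) (cycle_graph m) \<le> B"
proof -
  have "turan_counts n (path_graph k) (cycle_graph m) \<noteq> {}"
    using \<open>2 \<le> m\<close> by (intro turan_counts_nonempty edges_cycle_graph_nonempty) simp
  then have "gen_turan n (path_graph k) (cycle_graph m) \<in>
      turan_counts n (path_graph k) (cycle_graph m)"
    unfolding gen_turan_def by (rule Max_in[OF finite_turan_counts])
  then obtain G :: "nat sgraph" where G: "simple_graph G" "card (verts G) = n"
      "copies (cycle_graph m) G = {}"
      "gen_turan n (path_graph k) (cycle_graph m) = card (copies (path_graph k) G)"
    by (auto simp: turan_counts_def)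
  have "card (copies (path_graph k) G) \<le> card (paths (verts G) (adj G) k)"
    by (rule card_copies_path_le[OF G(1)])
  also have "\<dots> \<le> B"
    using G copies_cycle_graph_empty_iff[OF G(1) \<open>2 \<le> m\<close>]
    by (intro assms(2) fin_graph_adj) auto
  finally show ?thesis using G(4) by simp
qed

text \<open>For constructions on any vertex type with at most \<open>n\<close> vertices: the graph
  is embedded into \<open>{..<n}\<close> and the remaining vertices stay isolated.\<close>

lemma (in fin_graph) card_paths_le_gen_turan:
  assumes "2 \<le> m" "card V \<le> n" "\<not> has_cycle E m"
  shows "card (paths V E k) \<le> Suc k ^ Suc k * gen_turan n (path_graph k) (cycle_graph m)"
proof -
  have "card V \<le> card {..<n}" using assms(2) by simp
  then obtain f where f: "f ` V \<subseteq> {..<n}" "inj_on f V"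
    using fin by (metis card_le_inj finite_lessThan)
  define G where "G = ({..<n}, {{f u, f v} | u v. E u v})"
  have adj: "adj G a b \<longleftrightarrow> (\<exists>u v. E u v \<and> a = f u \<and> b = f v)" for a b
    unfolding adj_def G_def by (auto simp: doubleton_eq_iff intro: sym)
  have "f u \<noteq> f v" if "E u v" for u v
    using that in_V[OF that] in_V2[OF that] f(2) irrefl by (auto simp: inj_on_def)
  then have G: "simple_graph G"
    using in_V in_V2 subsetD[OF f(1)] by (force simp: simple_graph_def G_def)
  have m: "1 \<le> m" using \<open>2 \<le> m\<close> by simp
  have "\<not> has_cycle (adj G) m"
  proof
    assume "has_cycle (adj G) m"
    then obtain c where c: "\<And>i. adj G (c i) (c (Suc i))"
        "\<And>i j. c i = c j \<longleftrightarrow> i mod m = j mod m"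
      unfolding has_cycle_iff_periodic[OF m] by blast
    let ?g = "inv_into V f"
    have g: "?g (f v) = v" if "v \<in> V" for v
      using f(2) that by (rule inv_into_f_f)
    \<comment> \<open>Every vertex of the cycle has a neighbour and hence lies in the image of
      \<open>V\<close>.\<close>
    have "f (?g (c i)) = c i" for i
      using c(1)[of i] in_V g by (auto simp: adj)
    then have "?g (c i) = ?g (c j) \<longleftrightarrow> i mod m = j mod m" for i j
      using c(2) by metis
    moreover have "E (?g (c i)) (?g (c (Suc i)))" for i
      using c(1)[of i] in_V in_V2 g by (auto simp: adj)
    ultimately have "has_cycle E m"
      unfolding has_cycle_iff_periodic[OF m] by (intro exI[of _ "\<lambda>i. ?g (c i)"]) simp
    then show False using assms(3) by simp
  qed
  then have "copies (cycle_graph m) G = {}" "card (verts G) = n"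
    using copies_cycle_graph_empty_iff[OF G assms(1)] by (simp_all add: G_def)
  then have "card (copies (path_graph k) G) \<in> turan_counts n (path_graph k) (cycle_graph m)"
    unfolding turan_counts_def using G \<open>card (verts G) = n\<close> by blast
  then have le: "card (copies (path_graph k) G) \<le> gen_turan n (path_graph k) (cycle_graph m)"
    unfolding gen_turan_def by (rule Max_ge[OF finite_turan_counts])
  have "card (paths V E k) \<le> card (paths (verts G) (adj G) k)"
  proof (rule card_inj_on_le[of "map f"])
    show "inj_on (map f) (paths V E k)"
      using f(2) by (auto intro!: inj_on_subset[OF inj_on_map_lists] simp: paths_def)
    show "map f ` paths V E k \<subseteq> paths (verts G) (adj G) k"
    proof (rule image_subsetI)
      fix xs assume "xs \<in> paths V E k"
      then have xs: "length xs = Suc k" "set xs \<subseteq> V" "distinct xs" "successively E xs"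
        by (auto simp: paths_def)
      have "successively (\<lambda>u v. adj G (f u) (f v)) xs"
        using xs(4) by (rule successively_mono) (auto simp: adj)
      moreover have "set (map f xs) \<subseteq> verts G"
        using image_mono[OF xs(2), of f] f(1) by (simp add: G_def)
      moreover have "distinct (map f xs)"
        using xs(2,3) f(2) by (simp add: distinct_map inj_on_subset)
      ultimately show "map f xs \<in> paths (verts G) (adj G) k"
        using xs(1) by (simp add: paths_def successively_map)
    qed
    show "finite (paths (verts G) (adj G) k)"
      by (rule fin_graph.finite_paths[OF fin_graph_adj[OF G]])
  qed
  also have "\<dots> \<le> Suc k ^ Suc k * card (copies (path_graph k) G)"
    by (rule card_paths_le_copies[OF G])
  also have "\<dots> \<le> Suc k ^ Suc k * gen_turan n (path_graph k) (cycle_graph m)"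
    using le by (rule mult_left_mono) simp
  finally show ?thesis .
qed

section \<open>Subfields of the algebraic closure of the field with two elements\<close>

text \<open>A repeated linear factor would give a common root of \<open>p\<close> and its
  derivative, so the multiset of roots is a set.\<close>

lemma card_roots_simple:
  fixes p :: "'a :: alg_closed_field poly"
  assumes p: "p \<noteq> 0" and simple: "\<And>a. poly p a = 0 \<Longrightarrow> poly (pderiv p) a \<noteq> 0"
  shows "card {x. poly p x = 0} = degree p"
proof -
  obtain A where A: "size A = degree p" "p = smult (lead_coeff p) (\<Prod>x\<in>#A. [:- x, 1:])"
    using alg_closed_imp_factorization[OF p] by blast
  have "count A a \<le> 1" for a
  proof (rule ccontr)
    assume "\<not> count A a \<le> 1"
    then have "replicate_mset 2 a \<subseteq># A"
      by (simp flip: count_le_replicate_mset_subset_eq)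
    then obtain B where "A = replicate_mset 2 a + B"
      by (auto simp: mset_subset_eq_exists_conv)
    then have B: "A = add_mset a (add_mset a B)"
      by (simp add: numeral_2_eq_2)
    define r where "r = smult (lead_coeff p) (\<Prod>x\<in>#B. [:- x, 1:])"
    have r: "p = [:- a, 1:] * ([:- a, 1:] * r)"
      by (subst A(2)) (simp add: B r_def del: mult_pCons_left)
    have "poly p a = 0"
      by (subst r) (simp only: poly_mult, simp)
    moreover have "poly (pderiv p) a = 0"
      by (subst r) (simp only: pderiv_mult poly_add poly_mult, simp)
    ultimately show False using simple by blast
  qed
  then have "count A a = count (mset_set (set_mset A)) a" for a
    by (cases "a \<in># A") (auto simp: not_in_iff intro!: le_antisym)
  then have "A = mset_set (set_mset A)"
    by (rule multiset_eqI)
  then have "size A = card (set_mset A)"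
    by (metis size_mset_set)
  moreover have "{x. poly p x = 0} = set_mset A"
  proof -
    have "poly p x = lead_coeff p * (\<Prod>y\<in>#A. x - y)" for x
      by (subst A(2)) (simp add: poly_prod_mset multiset.map_comp comp_def)
    then show ?thesis using p by (auto simp: prod_mset_zero_iff)
  qed
  ultimately show ?thesis using A(1) by simp
qed

text \<open>\<open>K\<close> consists of the roots of \<open>x^q - x\<close> for
  \<open>q = 2 ^ r\<close>. They are simple because the derivative is \<open>-1\<close> in
  characteristic two, and the Frobenius identity gives closure under addition.\<close>

lemma ex_subfield_card_power_two:
  assumes "0 < r"
  obtains K :: "gf2 alg_closure set"
  where "card K = 2 ^ r" "\<And>x y. x \<in> K \<Longrightarrow> y \<in> K \<Longrightarrow> x + y \<in> K"
    "\<And>x y. x \<in> K \<Longrightarrow> y \<in> K \<Longrightarrow> x * y \<in> K" "\<And>x. x \<in> K \<Longrightarrow> - x \<in> K"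
proof -
  define q :: nat where "q = 2 ^ r"
  have q: "q \<ge> 2" using assms by (simp add: q_def self_le_power)
  let ?K = "{x :: gf2 alg_closure. x ^ q = x}"
  define p :: "gf2 alg_closure poly" where "p = monom 1 q - monom 1 1"
  have "(1 :: gf2) + 1 = 0"
    by transfer simp
  then have "CHAR(gf2) dvd 2"
    by (simp flip: of_nat_eq_0_iff_char_dvd)
  then have char: "CHAR(gf2 alg_closure) = 2"
    by (simp add: primes_dvd_imp_eq)
  have neg: "- x = x" for x :: "gf2 alg_closure"
  proof -
    have "(2 :: gf2 alg_closure) = 0"
      using of_nat_CHAR[where ?'a = "gf2 alg_closure"] unfolding char by simp
    then have "x + x = 0" by (simp flip: mult_2)
    then show ?thesis by (simp add: add_eq_0_iff2)
  qed
  have degree_p: "degree p = q"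
    using q unfolding p_def by (subst diff_conv_add_uminus, subst degree_add_eq_left) (simp_all add: degree_monom_eq)
  then have "p \<noteq> 0" using q by auto
  moreover have "poly (pderiv p) a = -1" for a
  proof -
    have "CHAR(gf2 alg_closure) dvd q"
      unfolding char q_def using assms by simp
    then have "of_nat q = (0 :: gf2 alg_closure)"
      by (simp only: of_nat_eq_0_iff_char_dvd)
    then show ?thesis
      by (simp add: p_def pderiv_diff pderiv_monom poly_monom)
  qed
  ultimately have "card {x. poly p x = 0} = q"
    using card_roots_simple[of p] degree_p by simp
  moreover have "{x. poly p x = 0} = ?K"
    by (auto simp: p_def poly_monom)
  ultimately have "card ?K = 2 ^ r" by (simp add: q_def)
  moreover have "x + y \<in> ?K" if "x \<in> ?K" "y \<in> ?K" for x y
    using that freshmans_dream'[where ?'a = "gf2 alg_closure", of q r x y] char q_def by simp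
  ultimately show ?thesis
    using that[of ?K] by (simp add: power_mult_distrib neg)
qed

section \<open>Graphs with many paths\<close>

text \<open>The induction step for lower bounds on numbers of lists that grow at the head.\<close>

lemma card_Cons_extensions_ge:
  assumes "finite B" and "\<And>xs. xs \<in> S \<Longrightarrow> d \<le> card {x. x # xs \<in> B}"
  shows "d * card S \<le> card B"
proof (cases "finite S")
  case True
  let ?F = "\<lambda>xs. {x. x # xs \<in> B}"
  have F: "finite (?F xs)" for xs
    using finite_imageI[OF \<open>finite B\<close>, of hd] by (rule rev_finite_subset) force
  have "d * card S \<le> (\<Sum>xs\<in>S. card (?F xs))"
    using sum_mono[of S "\<lambda>_. d"] assms(2) by (simp add: mult.commute)
  also have "\<dots> = card (SIGMA xs:S. ?F xs)"
    using True F by simp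
  also have "\<dots> \<le> card B"
    using assms(1) by (intro card_inj_on_le[of "\<lambda>(xs, x). x # xs"]) (auto simp: inj_on_def)
  finally show ?thesis .
qed simp

lemma (in fin_graph) card_paths_ge:
  assumes "\<And>u. u \<in> V \<Longrightarrow> d \<le> vdeg u"
  shows "card V * (d - k) ^ k \<le> card (paths V E k)"
proof -
  have "card V * (d - k) ^ j \<le> card (paths V E j)" if "j \<le> k" for j
    using that
  proof (induction j)
    case 0
    have "(\<lambda>v. [v]) ` V \<subseteq> paths V E 0" by (auto simp: paths_def)
    then have "card ((\<lambda>v. [v]) ` V) \<le> card (paths V E 0)"
      by (rule card_mono[OF finite_paths])
    then show ?case by (simp add: card_image inj_on_def)
  next
    case (Suc j)
    have "d - k \<le> card {x. x # xs \<in> paths V E (Suc j)}" if xs: "xs \<in> paths V E j" for xs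
    proof -
      have props: "length xs = Suc j" "set xs \<subseteq> V" "distinct xs" "successively E xs" "xs \<noteq> []"
        using xs by (auto simp: paths_def)
      have "d - k \<le> vdeg (hd xs) - card (set xs)"
        using props assms[of "hd xs"] Suc.prems by (simp add: distinct_card subset_iff diff_le_mono2 le_diff_conv)
      also have "\<dots> \<le> card (nbh (hd xs) - set xs)"
        by (rule diff_card_le_card_Diff) simp
      also have "\<dots> \<le> card {x. x # xs \<in> paths V E (Suc j)}"
      proof (rule card_mono)
        show "nbh (hd xs) - set xs \<subseteq> {x. x # xs \<in> paths V E (Suc j)}"
        proof
          fix x assume "x \<in> nbh (hd xs) - set xs"
          then have "E x (hd xs)" "x \<notin> set xs" "x \<in> V" using sym in_V by blast+
          then show "x \<in> {x. x # xs \<in> paths V E (Suc j)}"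
            using props by (simp add: paths_def successively_Cons)
        qed
        show "finite {x. x # xs \<in> paths V E (Suc j)}"
          using fin by (rule rev_finite_subset) (auto simp: paths_def)
      qed
      finally show ?thesis .
    qed
    then have "(d - k) * card (paths V E j) \<le> card (paths V E (Suc j))"
      by (rule card_Cons_extensions_ge[OF finite_paths])
    moreover have "(d - k) * (card V * (d - k) ^ j) \<le> (d - k) * card (paths V E j)"
      using Suc by (intro mult_left_mono) auto
    ultimately show ?case by (simp add: algebra_simps)
  qed
  then show ?thesis by simp
qed

section \<open>Blow-ups of the path\<close>

text \<open>The hubs are the vertices with an odd first coordinate.\<close>

definition blowup_verts :: "nat \<Rightarrow> nat \<Rightarrow> nat \<Rightarrow> (nat \<times> nat) set" where
  "blowup_verts k s t = (SIGMA i:{..k}. {..<if even i then s else t})"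

definition blowup_adj :: "nat \<Rightarrow> nat \<Rightarrow> nat \<Rightarrow> nat \<times> nat \<Rightarrow> nat \<times> nat \<Rightarrow> bool" where
  "blowup_adj k s t u v \<longleftrightarrow> u \<in> blowup_verts k s t \<and> v \<in> blowup_verts k s t \<and>
    (fst v = Suc (fst u) \<or> fst u = Suc (fst v))"

lemma finite_blowup_verts: "finite (blowup_verts k s t)"
  unfolding blowup_verts_def by (intro finite_SigmaI) auto

lemma fin_graph_blowup: "fin_graph (blowup_verts k s t) (blowup_adj k s t)"
  by unfold_locales (auto simp: blowup_adj_def finite_blowup_verts)

lemma card_blowup_verts_le: "card (blowup_verts k s t) \<le> Suc k * (s + t)"
proof -
  have "card (blowup_verts k s t) = (\<Sum>i\<le>k. if even i then s else t)"
    unfolding blowup_verts_def by (subst card_SigmaI) (auto intro: sum.cong)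
  also have "\<dots> \<le> (\<Sum>i\<le>k. s + t)"
    by (intro sum_mono) auto
  finally show ?thesis by simp
qed

text \<open>Only paths with one vertex in each layer are counted. They grow at the head, so the
  layers appear in descending order; \<open>(k + 2) div 2\<close> of them have size \<open>s\<close>
  and \<open>(k + 1) div 2\<close> have size \<open>t\<close>.\<close>

lemma card_paths_blowup_ge:
  "s ^ ((k + 2) div 2) * t ^ ((k + 1) div 2)
    \<le> card (paths (blowup_verts k s t) (blowup_adj k s t) k)"
proof -
  let ?V = "blowup_verts k s t" and ?E = "blowup_adj k s t"
  let ?B = "\<lambda>j. {xs \<in> paths ?V ?E j. map fst xs = rev [0..<Suc j]}"
  have fin: "finite (?B j)" for j
    using fin_graph.finite_paths[OF fin_graph_blowup] by (rule rev_finite_subset) blast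
  have "s ^ ((j + 2) div 2) * t ^ ((j + 1) div 2) \<le> card (?B j)" if "j \<le> k" for j
    using that
  proof (induction j)
    case 0
    have "(\<lambda>i. [(0, i)]) ` {..<s} \<subseteq> ?B 0"
      by (auto simp: paths_def blowup_verts_def)
    then have "card ((\<lambda>i. [(0 :: nat, i)]) ` {..<s}) \<le> card (?B 0)"
      by (rule card_mono[OF fin])
    then show ?case by (simp add: card_image inj_on_def)
  next
    case (Suc j)
    let ?d = "if even (Suc j) then s else t"
    have "?d \<le> card {x. x # xs \<in> ?B (Suc j)}" if xs: "xs \<in> ?B j" for xs
    proof -
      have props: "length xs = Suc j" "set xs \<subseteq> ?V" "distinct xs" "successively ?E xs" "xs \<noteq> []"
        "map fst xs = rev [0..<Suc j]"
        using xs by (auto simp: paths_def)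
      have "hd (map fst xs) = j"
        unfolding props(6) by simp
      then have hd: "fst (hd xs) = j" using props(5) by (simp add: hd_map)
      have small: "fst x < Suc j" if "x \<in> set xs" for x
      proof -
        have "fst x \<in> set (map fst xs)" using that by simp
        then show ?thesis unfolding props(6) by (auto simp: less_Suc_eq)
      qed
      have "Pair (Suc j) ` {..<?d} \<subseteq> {x. x # xs \<in> ?B (Suc j)}"
      proof (rule image_subsetI)
        fix i assume "i \<in> {..<?d}"
        then have "(Suc j, i) \<in> ?V"
          using Suc.prems by (auto simp: blowup_verts_def)
        moreover from this have "?E (Suc j, i) (hd xs)"
          using props(2,5) hd by (auto simp: blowup_adj_def)
        moreover have "(Suc j, i) \<notin> set xs" using small by fastforce
        ultimately show "(Suc j, i) \<in> {x. x # xs \<in> ?B (Suc j)}"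
          using props by (simp add: paths_def successively_Cons)
      qed
      moreover have "finite {x. x # xs \<in> ?B (Suc j)}"
        using finite_blowup_verts[of k s t] by (rule rev_finite_subset) (auto simp: paths_def)
      ultimately have "card (Pair (Suc j) ` {..<?d}) \<le> card {x. x # xs \<in> ?B (Suc j)}"
        by (intro card_mono)
      then show ?thesis by (simp add: card_image inj_on_def)
    qed
    then have step: "?d * card (?B j) \<le> card (?B (Suc j))"
      by (rule card_Cons_extensions_ge[OF fin])
    have IH: "?d * (s ^ ((j + 2) div 2) * t ^ ((j + 1) div 2)) \<le> ?d * card (?B j)"
      using Suc by (intro mult_left_mono) auto
    have "s ^ ((Suc j + 2) div 2) * t ^ ((Suc j + 1) div 2) =
        ?d * (s ^ ((j + 2) div 2) * t ^ ((j + 1) div 2))"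
      by (cases "even j") (auto elim!: evenE oddE)
    then show ?case using order_trans[OF IH step] by (simp only:)
  qed
  then have "s ^ ((k + 2) div 2) * t ^ ((k + 1) div 2) \<le> card (?B k)" by simp
  also have "\<dots> \<le> card (paths ?V ?E k)"
    using fin_graph.finite_paths[OF fin_graph_blowup] by (rule card_mono) blast
  finally show ?thesis .
qed

lemma mod_eq_add_imp_dvd: "(i :: nat) mod m = (i + d) mod m \<Longrightarrow> m dvd d"
  by (metis add_diff_cancel_left' le_add1 mod_eq_dvd_iff_nat)

text \<open>The neighbours on the cycle of the last hub lie in the layer before it, so that their other
  neighbours on the cycle are both the preceding hub, and the cycle closes after four steps.\<close>

lemma blowup_unit_no_cycle:
  assumes "4 < m"
  shows "\<not> has_cycle (blowup_adj k s 1) m"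
proof
  assume "has_cycle (blowup_adj k s 1) m"
  moreover have "1 \<le> m" using assms by simp
  ultimately obtain c where c: "\<And>i. blowup_adj k s 1 (c i) (c (Suc i))"
      and c_eq: "\<And>i j. c i = c j \<longleftrightarrow> i mod m = j mod m"
    using has_cycle_iff_periodic by blast
  define p where "p i = fst (c i)" for i
  have step: "p (Suc i) = Suc (p i) \<or> p i = Suc (p (Suc i))" for i
    using c[of i] by (auto simp: blowup_adj_def p_def)
  have le: "p i \<le> k" for i
    using c[of i] by (auto simp: blowup_adj_def blowup_verts_def p_def)
  have hub: "c i = c j" if "odd (p i)" "p i = p j" for i j
    using c[of i] c[of j] that
    by (auto simp: blowup_adj_def blowup_verts_def p_def prod_eq_iff)
  have "i mod m \<noteq> (i + d) mod m" if "0 < d" "d < m" for i d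
    using mod_eq_add_imp_dvd[of i m d] dvd_imp_le[of m d] that by auto
  from this[of 2] this[of 4]
  have ne: "c i \<noteq> c (Suc (Suc i))" "c i \<noteq> c (Suc (Suc (Suc (Suc i))))" for i
    using assms by (simp_all add: c_eq numeral_eq_Suc)
  obtain i0 where "odd (p i0)"
    using step[of 0] by (metis even_Suc)
  then have "\<exists>i. odd (p i) \<and> (\<forall>j. odd (p j) \<longrightarrow> p j \<le> p i)"
    using le by (intro ex_has_greatest_nat[of _ i0 p "Suc k"]) (auto simp: less_Suc_eq_le)
  then obtain j where j: "odd (p j)" "\<And>j'. odd (p j') \<Longrightarrow> p j' \<le> p j" by blast
  \<comment> \<open>The topmost hub gets the index \<open>i + 2\<close>, so that \<open>i\<close> to
    \<open>i + 4\<close> cover two steps on either side; the two full turns keep the subtraction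
    from being truncated.\<close>
  define i where "i = j + 2 * m - 2"
  have "Suc (Suc i) = j + 2 * m"
    using assms by (simp add: i_def)
  then have "c (Suc (Suc i)) = c j"
    by (simp only: c_eq mod_mult_self1)
  then have i: "odd (p (Suc (Suc i)))" "\<And>j'. odd (p j') \<Longrightarrow> p j' \<le> p (Suc (Suc i))"
    using j by (simp_all add: p_def)
  \<comment> \<open>Otherwise \<open>c i\<close> would be a hub no lower than the topmost one, hence
    the same hub, although positions two apart differ.\<close>
  have down1: "Suc (p (Suc i)) = p (Suc (Suc i))"
  proof (rule ccontr)
    assume "\<not> ?thesis"
    then have 1: "p (Suc i) = Suc (p (Suc (Suc i)))" using step[of "Suc i"] by auto
    then have "odd (p i)" using step[of i] i(1) by auto
    then have "p i = p (Suc (Suc i))" using step[of i] i(2)[of i] 1 by auto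
    then show False using hub ne(1) \<open>odd (p i)\<close> by blast
  qed
  have down2: "Suc (p (Suc (Suc (Suc i)))) = p (Suc (Suc i))"
  proof (rule ccontr)
    let ?q = "p (Suc (Suc (Suc (Suc i))))"
    assume "\<not> ?thesis"
    then have 1: "p (Suc (Suc (Suc i))) = Suc (p (Suc (Suc i)))"
      using step[of "Suc (Suc i)"] by auto
    then have "odd ?q" using step[of "Suc (Suc (Suc i))"] i(1) by auto
    then have "p (Suc (Suc i)) = ?q"
      using step[of "Suc (Suc (Suc i))"] i(2)[of "Suc (Suc (Suc (Suc i)))"] 1 by auto
    then show False using hub ne(1) i(1) by blast
  qed
  have "p i \<noteq> p (Suc (Suc i))" "p (Suc (Suc i)) \<noteq> p (Suc (Suc (Suc (Suc i))))"
    using hub ne(1) i(1) by metis+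
  then have down: "Suc (p i) = p (Suc i)"
      "Suc (p (Suc (Suc (Suc (Suc i))))) = p (Suc (Suc (Suc i)))"
    using down1 down2 step[of i] step[of "Suc (Suc (Suc i))"] by auto
  have "odd (p i)"
    using i(1) unfolding down1[symmetric] down(1)[symmetric] by simp
  \<comment> \<open>Both ends lie two layers below the topmost hub. Their layer has a single hub, so
    they coincide, although positions four apart differ.\<close>
  moreover have "p i = p (Suc (Suc (Suc (Suc i))))"
    using down1 down2 down by linarith
  ultimately show False using hub ne(2) by blast
qed

text \<open>Layer parities alternate along edges, so every second vertex of the cycle is a hub. This
  needs \<open>l\<close> distinct hubs, more than there are.\<close>

lemma blowup_few_hubs_no_cycle:
  assumes "(k + 1) div 2 * t < l"
  shows "\<not> has_cycle (blowup_adj k s t) (2 * l)"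
proof
  assume "has_cycle (blowup_adj k s t) (2 * l)"
  moreover have "1 \<le> 2 * l" using assms by simp
  ultimately obtain c where c: "\<And>i. blowup_adj k s t (c i) (c (Suc i))"
      and c_eq: "\<And>i j. c i = c j \<longleftrightarrow> i mod (2 * l) = j mod (2 * l)"
    using has_cycle_iff_periodic by blast
  have parity: "odd (fst (c (Suc i))) \<longleftrightarrow> even (fst (c i))" for i
    using c[of i] by (auto simp: blowup_adj_def)
  obtain r where r: "r \<le> 1" "odd (fst (c r))"
    using parity[of 0] by (cases "odd (fst (c 0))") auto
  have odd: "odd (fst (c (r + 2 * i)))" for i
    by (induction i) (use r parity in auto)
  let ?H = "(\<lambda>(a, j). (2 * a + 1, j)) ` ({..<(k + 1) div 2} \<times> {..<t})"
  have "(\<lambda>i. c (r + 2 * i)) ` {..<l} \<subseteq> ?H"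
  proof (rule image_subsetI)
    fix i
    obtain a where a: "fst (c (r + 2 * i)) = 2 * a + 1" using odd by (rule oddE)
    moreover have "c (r + 2 * i) \<in> blowup_verts k s t"
      using c by (simp add: blowup_adj_def)
    ultimately have "a < (k + 1) div 2" "snd (c (r + 2 * i)) < t"
      by (auto simp: blowup_verts_def)
    then show "c (r + 2 * i) \<in> ?H"
      using a by (intro image_eqI[of _ _ "(a, snd (c (r + 2 * i)))"]) (auto simp: prod_eq_iff)
  qed
  then have "card ((\<lambda>i. c (r + 2 * i)) ` {..<l}) \<le> card ?H"
    by (intro card_mono finite_imageI) auto
  also have "\<dots> \<le> (k + 1) div 2 * t"
    using card_image_le[of "{..<(k + 1) div 2} \<times> {..<t}"] by (simp add: card_cartesian_product)
  also have "card ((\<lambda>i. c (r + 2 * i)) ` {..<l}) = l"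
    using r(1) by (subst card_image) (auto simp: inj_on_def c_eq)
  finally show False using assms by simp
qed

section \<open>The incidence graph of points and lines\<close>

text \<open>The line with slope \<open>m\<close> and intercept \<open>c\<close> is stored as \<open>(m, - c)\<close>, so that incidence
  \<open>y + c' = x * m\<close> is symmetric in points and lines, which the boolean tag tells apart.\<close>

definition incidence_verts :: "'a set \<Rightarrow> (bool \<times> 'a \<times> 'a) set" where
  "incidence_verts K = UNIV \<times> K \<times> K"

definition incidence_adj ::
    "'a :: comm_ring_1 set \<Rightarrow> bool \<times> 'a \<times> 'a \<Rightarrow> bool \<times> 'a \<times> 'a \<Rightarrow> bool" where
  "incidence_adj K u v \<longleftrightarrow> u \<in> incidence_verts K \<and> v \<in> incidence_verts K \<and> fst u \<noteq> fst v \<and>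
    snd (snd u) + snd (snd v) = fst (snd u) * fst (snd v)"

lemma card_incidence_verts: "card (incidence_verts K) = 2 * card K ^ 2"
  by (simp add: incidence_verts_def card_cartesian_product power2_eq_square UNIV_bool)

lemma fin_graph_incidence:
  assumes "finite K"
  shows "fin_graph (incidence_verts K) (incidence_adj K)"
  using assms
  by unfold_locales (auto simp: incidence_adj_def incidence_verts_def add.commute mult.commute)

lemma incidence_no_4_cycle: "\<not> has_cycle (incidence_adj (K :: 'a :: idom set)) 4"
proof
  assume "has_cycle (incidence_adj K) 4"
  then obtain u v w z where cyc: "distinct [u, v, w, z]" "incidence_adj K u v"
      "incidence_adj K v w" "incidence_adj K w z" "incidence_adj K z u"
    by (auto simp: has_cycle_def length_Suc_conv numeral_eq_Suc)
  obtain b x y where u: "u = (b, x, y)" by (metis prod_cases3)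
  obtain b1 m c where v: "v = (b1, m, c)" by (metis prod_cases3)
  obtain b2 x' y' where w: "w = (b2, x', y')" by (metis prod_cases3)
  obtain b3 m' c' where z: "z = (b3, m', c')" by (metis prod_cases3)
  have b: "b2 = b" "b3 = b1"
    using cyc by (auto simp: u v w z incidence_adj_def)
  have eqs: "y + c = x * m" "c + y' = m * x'" "y' + c' = x' * m'" "c' + y = m' * x"
    using cyc by (auto simp: u v w z incidence_adj_def)
  \<comment> \<open>The product is the alternating sum of the four incidence equations. Hence two
    points on two common lines share a coordinate \<open>x\<close>, or the lines share a slope, and
    the equations force equality.\<close>
  have "(x - x') * (m - m') = x * m - m' * x - m * x' + x' * m'"
    by (simp add: algebra_simps)
  also have "\<dots> = 0"
    unfolding eqs[symmetric] by simp
  finally have "x = x' \<or> m = m'" by simp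
  then have "(x = x' \<and> y = y') \<or> (m = m' \<and> c = c')"
    using eqs by (metis add_left_cancel add.commute mult.commute)
  then show False using cyc(1) b by (auto simp: u v w z)
qed

lemma incidence_deg:
  assumes K: "finite K" and closed: "\<And>x y. x \<in> K \<Longrightarrow> y \<in> K \<Longrightarrow> x + y \<in> K"
    "\<And>x y. x \<in> K \<Longrightarrow> y \<in> K \<Longrightarrow> x * y \<in> K" "\<And>x. x \<in> K \<Longrightarrow> - x \<in> K"
    and "u \<in> incidence_verts K"
  shows "card K \<le> card {v. incidence_adj K u v}"
proof -
  obtain b x y where u: "u = (b, x, y)" by (metis prod_cases3)
  then have xy: "x \<in> K" "y \<in> K" using assms(5) by (auto simp: incidence_verts_def)
  let ?f = "\<lambda>m. (\<not> b, m, x * m - y)"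
  have "?f ` K \<subseteq> {v. incidence_adj K u v}"
  proof (rule image_subsetI)
    fix m assume m: "m \<in> K"
    then have "x * m - y \<in> K"
      using closed(1)[OF closed(2)[OF xy(1) m] closed(3)[OF xy(2)]] by simp
    then show "?f m \<in> {v. incidence_adj K u v}"
      using xy m by (simp add: u incidence_adj_def incidence_verts_def)
  qed
  moreover have "finite {v. incidence_adj K u v}"
    by (rule finite_subset[of _ "incidence_verts K"])
      (auto simp: incidence_adj_def incidence_verts_def K)
  ultimately have "card (?f ` K) \<le> card {v. incidence_adj K u v}"
    by (intro card_mono)
  then show ?thesis by (simp add: card_image inj_on_def)
qed

section \<open>Bounds on the generalized Turan number\<close>

lemma gen_turan_le_if_C4:
  "real (gen_turan n (path_graph k) (cycle_graph 4)) \<le> 2 * real n powr (real k / 2 + 1)"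
proof -
  \<comment> \<open>The transfer lemma takes a bound in the natural numbers, hence the
    floor.\<close>
  have "gen_turan n (path_graph k) (cycle_graph 4) \<le> nat \<lfloor>2 * real n powr (real k / 2 + 1)\<rfloor>"
  proof (rule gen_turan_le)
    fix V :: "nat set" and E assume "fin_graph V E" "card V = n" "\<not> has_cycle E 4"
    then have "real (card (paths V E k)) \<le> 2 * real n powr (real k / 2 + 1)"
      using fin_graph.card_paths_le_if_C4_free by blast
    then show "card (paths V E k) \<le> nat \<lfloor>2 * real n powr (real k / 2 + 1)\<rfloor>"
      by (simp add: le_nat_floor)
  qed simp
  then have "real (gen_turan n (path_graph k) (cycle_graph 4)) \<le>
      real (nat \<lfloor>2 * real n powr (real k / 2 + 1)\<rfloor>)"
    by (rule of_nat_mono)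
  also have "\<dots> \<le> 2 * real n powr (real k / 2 + 1)"
    by (rule of_nat_floor) simp
  finally show ?thesis .
qed

lemma gen_turan_ge_if_C4:
  assumes n: "32 * Suc k ^ 2 \<le> n"
  shows "real n powr (real k / 2 + 1) \<le>
    real ((16 * Suc k) ^ Suc k * gen_turan n (path_graph k) (cycle_graph 4))"
proof -
  have "1 \<le> n div 2" using n by (simp add: power2_eq_square)
  \<comment> \<open>The largest power of four up to \<open>n / 2\<close> gives \<open>q\<close> with
    \<open>2 * q^2 \<le> n < 8 * q^2\<close>, so the incidence graph fits and loses only a constant
    factor.\<close>
  then obtain r where r: "4 ^ r \<le> n div 2" "n div 2 < 4 ^ (r + 1)"
    using ex_power_ivl1[of 4 "n div 2"] by auto
  define q :: nat where "q = 2 ^ r"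
  have q2: "q\<^sup>2 = 4 ^ r" by (simp add: q_def flip: power_mult power_mult_distrib) (simp add: power_mult mult.commute[of r])
  have q: "2 * q\<^sup>2 \<le> n" "n < 8 * q\<^sup>2"
    using r unfolding q2 by simp_all
  have "(2 * Suc k)\<^sup>2 < q\<^sup>2" using n q(2) by (simp add: power2_eq_square)
  then have qk: "2 * Suc k < q" by (rule power_less_imp_less_base) simp
  then have "0 < r" by (cases r) (auto simp: q_def)
  then obtain K :: "gf2 alg_closure set" where K: "card K = q"
    "\<And>x y. x \<in> K \<Longrightarrow> y \<in> K \<Longrightarrow> x + y \<in> K"
    "\<And>x y. x \<in> K \<Longrightarrow> y \<in> K \<Longrightarrow> x * y \<in> K" "\<And>x. x \<in> K \<Longrightarrow> - x \<in> K"
    unfolding q_def by (rule ex_subfield_card_power_two) blast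
  have "finite K" using K(1) qk by (auto intro: card_ge_0_finite)
  interpret fin_graph "incidence_verts K" "incidence_adj K"
    by (rule fin_graph_incidence[OF \<open>finite K\<close>])
  let ?g = "gen_turan n (path_graph k) (cycle_graph 4)"
  have "2 * q\<^sup>2 * (q - k) ^ k \<le> card (paths (incidence_verts K) (incidence_adj K) k)"
    using card_paths_ge[of q k] incidence_deg[OF \<open>finite K\<close> K(2-4)]
    unfolding card_incidence_verts K(1) by blast
  also have "\<dots> \<le> Suc k ^ Suc k * ?g"
    using q(1) by (intro card_paths_le_gen_turan incidence_no_4_cycle)
      (simp_all add: card_incidence_verts K(1))
  finally have lower: "2 * q\<^sup>2 * (q - k) ^ k \<le> Suc k ^ Suc k * ?g" .
  have "q ^ (k + 2) = q\<^sup>2 * q ^ k" by (subst power_add) (rule mult.commute)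
  \<comment> \<open>As \<open>q\<close> exceeds \<open>2 * k\<close>, the degree left for greedy
    extension is at least half of \<open>q\<close>.\<close>
  also have "\<dots> \<le> q\<^sup>2 * (2 * (q - k)) ^ k"
    using qk by (intro mult_left_mono power_mono) auto
  also have "\<dots> \<le> 2 ^ k * (2 * q\<^sup>2 * (q - k) ^ k)"
    by (simp add: power_mult_distrib)
  also have "\<dots> \<le> 2 ^ k * (Suc k ^ Suc k * ?g)"
    using lower by (rule mult_left_mono) simp
  finally have "8 ^ Suc k * q ^ (k + 2) \<le> 8 ^ Suc k * (2 ^ k * (Suc k ^ Suc k * ?g))"
    by (rule mult_left_mono) simp
  also have "\<dots> \<le> 8 ^ Suc k * (2 ^ Suc k * (Suc k ^ Suc k * ?g))"
    by (intro mult_left_mono mult_right_mono power_increasing) auto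
  also have "\<dots> = (16 * Suc k) ^ Suc k * ?g"
    unfolding power_mult_distrib mult.assoc[symmetric]
    by (simp only: power_mult_distrib[symmetric]) simp
  finally have nat_bound: "8 ^ Suc k * q ^ (k + 2) \<le> (16 * Suc k) ^ Suc k * ?g" .
  have "0 < real q" using qk by simp
  have "real n powr (real k / 2 + 1) \<le> (8 * real q powr 2) powr (real k / 2 + 1)"
  proof (rule powr_mono2)
    have "real n < real (8 * q\<^sup>2)" using q(2) by (simp only: of_nat_less_iff)
    then show "real n \<le> 8 * real q powr 2" using \<open>0 < real q\<close> by (simp add: powr_numeral)
  qed auto
  also have "\<dots> = 8 powr (real k / 2 + 1) * real q powr real (k + 2)"
    by (simp add: powr_mult powr_powr algebra_simps del: powr_numeral)
  also have "\<dots> \<le> 8 powr real (Suc k) * real q powr real (k + 2)"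
  proof (rule mult_right_mono)
    show "8 powr (real k / 2 + 1) \<le> (8 :: real) powr real (Suc k)"
      by (rule powr_mono) auto
  qed simp
  also have "\<dots> = real (8 ^ Suc k * q ^ (k + 2))"
    using \<open>0 < real q\<close> by (simp only: powr_realpow zero_less_numeral) simp
  also have "\<dots> \<le> real ((16 * Suc k) ^ Suc k * ?g)"
    using nat_bound by (rule of_nat_mono)
  finally show ?thesis .
qed

lemma gen_turan_le_if_even_cycle:
  assumes "3 \<le> l" "2 \<le> k"
  shows "gen_turan n (path_graph k) (cycle_graph (2 * l)) \<le>
    64 ^ k * l ^ ((k + 1) div 2) * n ^ ((k + 2) div 2)"
proof (rule gen_turan_le)
  fix V :: "nat set" and E assume "fin_graph V E" "card V = n" "\<not> has_cycle E (2 * l)"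
  then show "card (paths V E k) \<le> 64 ^ k * l ^ ((k + 1) div 2) * n ^ ((k + 2) div 2)"
    using fin_graph.card_paths_le assms by blast
qed (use assms in simp)

lemma gen_turan_ge_if_even_cycle:
  assumes l: "3 \<le> l" and "1 \<le> k" and n: "2 * Suc k * (l + 1) \<le> n"
  shows "l ^ ((k + 1) div 2) * n ^ ((k + 2) div 2) \<le>
    (4 * Suc k * Suc k) ^ Suc k * gen_turan n (path_graph k) (cycle_graph (2 * l))"
proof -
  define h where "h = (k + 1) div 2"
  \<comment> \<open>The largest \<open>t\<close> with \<open>h * t < l\<close>, where
    \<open>h\<close> counts the hub layers. For \<open>l \<le> h\<close> this would be zero, and
    single hubs are used instead.\<close>
  define t where "t = max 1 ((l - 1) div h)"
  \<comment> \<open>The layers without hubs take up at most half of the \<open>n\<close> vertices,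
    which leaves the other half to the hubs.\<close>
  define s where "s = n div (2 * Suc k)"
  have h: "1 \<le> h" "h \<le> Suc k" using \<open>1 \<le> k\<close> by (auto simp: h_def)
  have free: "\<not> has_cycle (blowup_adj k s t) (2 * l)"
  proof (cases "l - 1 < h")
    case True
    then have "t = 1" by (simp add: t_def)
    then show ?thesis using blowup_unit_no_cycle[of "2 * l"] l by simp
  next
    case False
    then have "1 \<le> (l - 1) div h" using h(1) by (simp add: div_greater_zero_iff Suc_le_eq)
    then have "h * t \<le> l - 1" by (simp add: t_def)
    then show ?thesis using l by (intro blowup_few_hubs_no_cycle) (simp add: h_def)
  qed
  have "1 \<le> t" by (simp add: t_def)
  have lt: "l \<le> 4 * Suc k * t"
  proof -
    have "l - 1 < h + h * ((l - 1) div h)"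
      using h(1) by (intro dividend_less_times_div) simp
    also have "\<dots> \<le> h + h * t"
      by (intro add_left_mono mult_left_mono) (simp_all add: t_def)
    also have "\<dots> \<le> h * t + h * t"
      using \<open>1 \<le> t\<close> by simp
    also have "\<dots> \<le> Suc k * t + Suc k * t"
      using h(2) by (intro add_mono mult_right_mono) auto
    finally have "l \<le> Suc k * t + Suc k * t" by linarith
    then show ?thesis by (simp add: algebra_simps)
  qed
  have "t \<le> l"
    using l by (auto simp: t_def intro: order_trans[OF div_le_dividend])
  have "2 * Suc k * s \<le> n"
    unfolding s_def by (rule times_div_less_eq_dividend)
  moreover have "2 * Suc k * t \<le> n"
    using n mult_le_mono2[OF \<open>t \<le> l\<close>, of "2 * Suc k"] by simp
  ultimately have "Suc k * (s + t) \<le> n" by (simp add: algebra_simps)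
  then have card: "card (blowup_verts k s t) \<le> n"
    using card_blowup_verts_le order_trans by blast
  have "2 * Suc k \<le> n" using n by simp
  then have "1 \<le> s" by (simp add: s_def div_greater_zero_iff Suc_le_eq)
  have "n < 2 * Suc k * s + 2 * Suc k"
    unfolding s_def by (metis dividend_less_times_div mult_Suc_right add.commute zero_less_Suc mult_pos_pos zero_less_numeral)
  then have ns: "n \<le> 4 * Suc k * s"
    using mult_le_mono2[OF \<open>1 \<le> s\<close>, of "2 * Suc k"] by (simp add: algebra_simps)
  let ?g = "gen_turan n (path_graph k) (cycle_graph (2 * l))"
  have "s ^ ((k + 2) div 2) * t ^ ((k + 1) div 2) \<le> Suc k ^ Suc k * ?g"
    by (rule order_trans[OF card_paths_blowup_ge
          fin_graph.card_paths_le_gen_turan[OF fin_graph_blowup _ card free]]) (use l in simp)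
  then have lower: "(4 * Suc k) ^ Suc k * (s ^ ((k + 2) div 2) * t ^ ((k + 1) div 2)) \<le>
      (4 * Suc k) ^ Suc k * (Suc k ^ Suc k * ?g)"
    by (rule mult_left_mono) simp
  have exponents: "(k + 1) div 2 + (k + 2) div 2 = Suc k" by presburger
  have "l ^ ((k + 1) div 2) * n ^ ((k + 2) div 2) \<le>
      (4 * Suc k * t) ^ ((k + 1) div 2) * (4 * Suc k * s) ^ ((k + 2) div 2)"
    using lt ns by (intro mult_mono power_mono) auto
  also have "\<dots> = (4 * Suc k) ^ ((k + 1) div 2 + (k + 2) div 2) *
      (s ^ ((k + 2) div 2) * t ^ ((k + 1) div 2))"
    by (simp only: power_mult_distrib power_add mult_ac)
  also have "\<dots> \<le> (4 * Suc k) ^ Suc k * (Suc k ^ Suc k * ?g)"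
    unfolding exponents by (rule lower)
  also have "\<dots> = (4 * Suc k * Suc k) ^ Suc k * ?g"
    by (simp only: power_mult_distrib mult.assoc)
  finally show ?thesis .
qed

theorem theorem6:
  fixes k :: nat
  assumes "k \<ge> 2"
  shows "uniform_theta {2..}
    (\<lambda>n l. real (gen_turan n (path_graph k) (cycle_graph (2 * l))))
    (\<lambda>n l. if l = 2 then real n powr (real k / 2 + 1)
            else real l ^ nat \<lfloor>(real k + 1) / 2\<rfloor> * real n ^ nat \<lceil>(real k + 1) / 2\<rceil>)"
proof -
  have floor: "nat \<lfloor>(real k + 1) / 2\<rfloor> = (k + 1) div 2"
    using floor_divide_of_nat_eq[of "k + 1" 2, where ?'a = real] by (simp add: add.commute)
  have ceil: "nat \<lceil>(real k + 1) / 2\<rceil> = (k + 2) div 2"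
    by (cases "even k") (auto elim!: evenE oddE simp: ceiling_unique, linarith+)
  let ?g = "\<lambda>n l. real (gen_turan n (path_graph k) (cycle_graph (2 * l)))"
  let ?h = "\<lambda>n l. if l = 2 then real n powr (real k / 2 + 1)
    else real l ^ ((k + 1) div 2) * real n ^ ((k + 2) div 2)"
  \<comment> \<open>A common constant: the two lower bounds lose \<open>c ^ Suc k\<close> with
    \<open>c = 16 * Suc k\<close> and \<open>c = 4 * Suc k * Suc k\<close>.\<close>
  let ?C = "real ((16 * Suc k * Suc k) ^ Suc k)"
  let ?a = "1 / ?C" and ?A = "64 ^ k :: real"
  have C_nat: "0 < (16 * Suc k * Suc k) ^ Suc k" by (rule zero_less_power) simp
  then have C: "0 < ?C" unfolding of_nat_0_less_iff .
  have "uniform_theta {2..} ?g ?h"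
    unfolding uniform_theta_def
  proof (rule exI[of _ ?a], rule exI[of _ ?A], intro conjI ballI allI impI)
    show "0 < ?a" using C by (simp only: zero_less_divide_1_iff)
    have "real 1 \<le> ?C" using C_nat by (intro of_nat_mono) linarith
    then have "1 \<le> ?C" by (simp only: of_nat_1)
    then have "?a \<le> 1" using C by (simp only: divide_le_eq_1_pos)
    also have "1 \<le> ?A" by simp
    finally show "?a \<le> ?A" .
  next
    fix l n :: nat assume l: "l \<in> {2..}"
    show "?g n l \<le> ?A * ?h n l"
    proof (cases "l = 2")
      case True
      have "(2 :: real) \<le> ?A"
        using assms self_le_power[of "64 :: real" k] by simp
      then have "2 * real n powr (real k / 2 + 1) \<le> ?A * real n powr (real k / 2 + 1)"
        by (rule mult_right_mono) simp
      then show ?thesis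
        using gen_turan_le_if_C4[of n k] True by simp
    next
      case False
      then have "3 \<le> l" using l by simp
      from gen_turan_le_if_even_cycle[OF this assms, of n]
      have "real (gen_turan n (path_graph k) (cycle_graph (2 * l))) \<le>
          real (64 ^ k * l ^ ((k + 1) div 2) * n ^ ((k + 2) div 2))"
        by (rule of_nat_mono)
      then show ?thesis using False by (simp add: mult.assoc)
    qed
  next
    fix l :: nat assume l: "l \<in> {2..}"
    have scale: "?a * x \<le> y" if "x \<le> real (c ^ Suc k) * y" "c \<le> 16 * Suc k * Suc k" "0 \<le> y"
      for x y :: real and c :: nat
    proof -
      have "real (c ^ Suc k) * y \<le> ?C * y"
        using that(2,3) by (intro mult_right_mono of_nat_mono power_mono) auto
      then have "x \<le> ?C * y" using that(1) by linarith
      with C show ?thesis by (simp add: pos_divide_le_eq mult.commute del: of_nat_power of_nat_mult)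
    qed
    show "\<exists>n0. \<forall>n\<ge>n0. ?a * ?h n l \<le> ?g n l"
    proof (cases "l = 2")
      case True
      have "?a * ?h n l \<le> ?g n l" if "32 * Suc k ^ 2 \<le> n" for n
        using gen_turan_ge_if_C4[OF that] True
        by (intro scale[of _ "16 * Suc k"]) (simp_all only: of_nat_mult, simp_all)
      then show ?thesis by blast
    next
      case False
      then have "3 \<le> l" using l by simp
      have "?a * ?h n l \<le> ?g n l" if "2 * Suc k * (l + 1) \<le> n" for n
      proof (rule scale[of _ "4 * Suc k * Suc k"])
        have "1 \<le> k" using assms by simp
        from of_nat_mono[OF gen_turan_ge_if_even_cycle[OF \<open>3 \<le> l\<close> this that], where ?'a = real]
        show "?h n l \<le> real ((4 * Suc k * Suc k) ^ Suc k) * ?g n l"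
          using False by (simp only: of_nat_mult of_nat_power if_False)
        show "4 * Suc k * Suc k \<le> 16 * Suc k * Suc k"
          by (intro mult_right_mono) simp_all
      qed simp
      then show ?thesis by blast
    qed
  qed
  then show ?thesis unfolding floor ceil .
qed

end
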